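(* There exist absolute constants $C_1,C_2>0$ such that the following holds. Let $d\in\mathbb N$, $k\in\{1,\dots,d\}$, $\Delta,\Gamma\in(0,1)$, and let $\mathbf M\in\mathbb R^{d\times d}$ be symmetric positive semidefinite with $\lambda_k(\mathbf M)>0$ and $\Delta\cdot\kappa_k(\mathbf M)^2\le\Gamma^2$. Set $$\delta:=\frac{\Delta}{k^{C_1\log k}},\qquad \gamma:=\frac{\Gamma}{C_2k^3},$$ and let $\mathcal O$ be a $(\delta,\gamma)$-approximate $1$-cPCA oracle. Then the deflation algorithm $\mathsf{BlackBoxPCA}(\mathbf M,k,\mathcal O)$ returns $\mathbf U\in\mathbb R^{d\times k}$ which is a $(\Delta,\Gamma)$-approximate correlation $k$-PCA ($(\Delta,\Gamma)$-$k$-cPCA) of $\mathbf M$.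
   Context: A matrix $\mathbf V\in\mathbb R^{d\times r}$ is orthonormal if $\mathbf V^\top\mathbf V=\mathbf I_r$. $\lambda_i(\mathbf M)$ is the $i$-th largest eigenvalue, $\kappa_k(\mathbf M):=\lambda_1(\mathbf M)/\lambda_k(\mathbf M)$, and $\mathbf V^{<\lambda}(\mathbf M)$ is an orthonormal matrix whose columns span the eigenspace of $\mathbf M$ corresponding to eigenvalues $<\lambda$. $\|\cdot\|_F$ is the Frobenius norm. Correlation $k$-PCA: for $\Gamma\in[0,1]$, $\Delta\in[0,k]$, an orthonormal $\mathbf U\in\mathbb R^{d\times k}$ is a $(\Delta,\Gamma)$-$k$-cPCA of $\mathbf M$ if $\|(\mathbf V^{<(1-\Gamma)\lambda_k(\mathbf M)}(\mathbf M))^\top\mathbf U\|_F^2\le\Delta$. cPCA oracle: $\mathcal O$ is a $(\delta,\gamma)$-approximate $1$-cPCA oracle if, on any inputs $\mathbf M$ (a $d\times d$ symmetric positive semidefinite matrix) and $\mathbf P$ (a $d\times d$ orthogonal projection matrix), it returns a unit vector $u\in\mathrm{span}(\mathbf P)$ (column span) which is a $(\delta,\gamma)$-$1$-cPCA of $\mathbf P\mathbf M\mathbf P$. Algorithm $\mathsf{BlackBoxPCA}(\mathbf M,k,\mathcal O)$: set $\mathbf P_0=\mathbf I_d$; for $i=1,\dots,k$: let $u_i=\mathcal O(\mathbf M,\mathbf P_{i-1})$ and $\mathbf P_i=\mathbf P_{i-1}-u_iu_i^\top$. Return $\mathbf U\in\mathbb R^{d\times k}$ with columns $u_1,\dots,u_k$.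 *)

theory Defs
  imports
    Complex_Main
    "Jordan_Normal_Form.Char_Poly"
    "Jordan_Normal_Form.VS_Connect"
begin

text \<open>Real matrices are modelled by \<^typ>\<open>real mat\<close>, so that the dimension is an
  ordinary natural number and constants can be chosen independently of it. Matrices with
  \<open>0\<close> columns are allowed, which matters for eigenspaces that happen to be trivial.\<close>

definition orthonormal_cols :: "real mat \<Rightarrow> bool" where
  "orthonormal_cols V \<longleftrightarrow> transpose_mat V * V = 1\<^sub>m (dim_col V)"

definition psd_mat :: "nat \<Rightarrow> real mat \<Rightarrow> bool" where
  "psd_mat d M \<longleftrightarrow> M \<in> carrier_mat d d \<and> transpose_mat M = M \<and>
     (\<forall>v \<in> carrier_vec d. 0 \<le> v \<bullet> (M *\<^sub>v v))"

definition orth_proj_mat :: "nat \<Rightarrow> real mat \<Rightarrow> bool" where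
  "orth_proj_mat d P \<longleftrightarrow> P \<in> carrier_mat d d \<and> transpose_mat P = P \<and> P * P = P"

definition frob_norm :: "real mat \<Rightarrow> real" where
  "frob_norm A = sqrt (\<Sum>i<dim_row A. \<Sum>j<dim_col A. (A $$ (i, j))\<^sup>2)"

definition col_span :: "real mat \<Rightarrow> real vec set" where
  "col_span A = LinearCombinations.module.span class_ring (module_vec TYPE(real) (dim_row A)) (set (cols A))"

text \<open>Eigenvalues with multiplicity, in decreasing order. The list exists whenever the
  characteristic polynomial splits over the reals, in particular for symmetric matrices, where
  algebraic and geometric multiplicities coincide; it is always unique.\<close>

definition eigvals_desc :: "real mat \<Rightarrow> real list" where
  "eigvals_desc M =
     (THE xs. sorted_wrt (\<ge>) xs \<and> char_poly M = (\<Prod>x\<leftarrow>xs. [:- x, 1:]))"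

text \<open>The index of an eigenvalue starts at \<open>1\<close>.\<close>

definition eigval :: "nat \<Rightarrow> real mat \<Rightarrow> real" where
  "eigval i M = eigvals_desc M ! (i - 1)"

definition cond_num :: "nat \<Rightarrow> real mat \<Rightarrow> real" where
  "cond_num k M = eigval 1 M / eigval k M"

definition eigspace_less :: "real \<Rightarrow> real mat \<Rightarrow> real vec set" where
  "eigspace_less l M =
     LinearCombinations.module.span class_ring (module_vec TYPE(real) (dim_row M)) {v. \<exists>\<mu><l. eigenvector M v \<mu>}"

text \<open>The matrix is unique only up to right multiplication by an orthogonal matrix; this does not
  affect \<^term>\<open>frob_norm (transpose_mat (V_less l M) * U)\<close>.\<close>

definition V_less :: "real \<Rightarrow> real mat \<Rightarrow> real mat" where
  "V_less l M = (SOME V. dim_row V = dim_row M \<and> orthonormal_cols V \<and>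
     col_span V = eigspace_less l M)"

text \<open>The parameters are intended to satisfy \<open>0 \<le> \<Gamma> \<le> 1\<close> and \<open>0 \<le> \<Delta> \<le> k\<close>. This is not part of
  the definition, so an oracle assumption can never fail merely by a parameter being out of
  range.\<close>

definition is_cPCA :: "nat \<Rightarrow> nat \<Rightarrow> real \<Rightarrow> real \<Rightarrow> real mat \<Rightarrow> real mat \<Rightarrow> bool" where
  "is_cPCA d k \<Delta> \<Gamma> M U \<longleftrightarrow> U \<in> carrier_mat d k \<and> orthonormal_cols U \<and>
     (frob_norm (transpose_mat (V_less ((1 - \<Gamma>) * eigval k M) M) * U))\<^sup>2 \<le> \<Delta>"

text \<open>The projection \<open>P = 0\<close> has to be excluded, since its span contains no unit vector and the
  oracle assumption would be contradictory.\<close>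

definition is_cPCA_oracle ::
    "nat \<Rightarrow> real \<Rightarrow> real \<Rightarrow> (real mat \<Rightarrow> real mat \<Rightarrow> real vec) \<Rightarrow> bool" where
  "is_cPCA_oracle d \<delta> \<gamma> orc \<longleftrightarrow>
     (\<forall>M P. psd_mat d M \<and> orth_proj_mat d P \<and> P \<noteq> 0\<^sub>m d d \<longrightarrow>
        orc M P \<in> col_span P \<and> orc M P \<bullet> orc M P = 1 \<and>
        is_cPCA d 1 \<delta> \<gamma> (P * M * P) (mat_of_cols d [orc M P]))"

definition outer_prod :: "real vec \<Rightarrow> real vec \<Rightarrow> real mat" where
  "outer_prod u v = mat (dim_vec u) (dim_vec v) (\<lambda>(i, j). u $ i * v $ j)"

text \<open>\<open>deflation_proj\<close> takes the dimension from \<open>M\<close>; \<open>deflation_proj orc M i\<close> is the projection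
  after \<open>i\<close> deflation steps.\<close>

fun deflation_proj :: "(real mat \<Rightarrow> real mat \<Rightarrow> real vec) \<Rightarrow> real mat \<Rightarrow> nat \<Rightarrow> real mat" where
  "deflation_proj orc M 0 = 1\<^sub>m (dim_row M)"
| "deflation_proj orc M (Suc i) =
     (let P = deflation_proj orc M i; u = orc M P in P - outer_prod u u)"

definition BlackBoxPCA ::
    "real mat \<Rightarrow> nat \<Rightarrow> (real mat \<Rightarrow> real mat \<Rightarrow> real vec) \<Rightarrow> real mat" where
  "BlackBoxPCA M k orc =
     mat_of_cols (dim_row M) (map (\<lambda>i. orc M (deflation_proj orc M i)) [0..<k])"

end

theory Submission
  imports Defs "HOL-Analysis.Function_Topology" "HOL-Analysis.L2_Norm"
begin

text \<open>
  Let \<open>lam 0 \<ge> lam 1 \<ge> \<dots>\<close> be the eigenvalues of \<open>M\<close> with orthonormal eigenvectors \<open>e l\<close>, let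
  \<open>u 0, \<dots>, u (k - 1)\<close> be the vectors returned, \<open>P i\<close> the projection onto the complement of the first
  \<open>i\<close> of them, and \<open>nu i 0\<close> the top eigenvalue of the compression \<open>P i * M * P i\<close>. Put
  \<open>G = \<Gamma> / (2 k)\<close> and call \<open>e l\<close> low for \<open>q\<close> if \<open>lam l < (1 - G) lam (q - 1)\<close>. Strong induction on
  \<open>q\<close> shows that \<open>u 0, \<dots>, u (q - 1)\<close> together have squared mass at most \<open>(1 + 1/k)^q * 2 q \<delta>\<close> on the
  vectors that are low for \<open>q\<close> (\<open>low_mass_bound\<close>). For \<open>q = k\<close> this is at most \<open>6 k \<delta> \<le> \<Delta>\<close>, and
  \<open>G \<le> \<Gamma>\<close> makes it the assertion.

  One step of the algorithm: up to mass \<open>\<delta>\<close>, \<open>u i\<close> lies in the span of the eigenvectors of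
  \<open>P i * M * P i\<close> with eigenvalue at least \<open>\<mu> = (1 - \<gamma>) nu i 0\<close>. A vector \<open>a\<close> of that span is the image
  of some \<open>c\<close> in it with \<open>|c| \<le> |a| / \<mu>\<close>, that is, \<open>a = M c - (\<Sum>j<i. (u j \<bullet> M c) u j)\<close>. On the low
  eigenvectors \<open>M\<close> is at most \<open>\<theta> = (1 - G) lam (q - 1)\<close>, so taking the supremum over the unit ball
  of the span bounds the low part of \<open>a\<close> by the low parts of the earlier \<open>u j\<close>, times the cross terms
  \<open>u j \<bullet> M c\<close>, divided by \<open>\<mu> - \<theta>\<close> (\<open>top_space_low_part\<close>). If the cross terms are at most
  \<open>G lam (q - 1) / (4 k\<^sup>2)\<close>, the accumulated low mass grows by no more than a factor \<open>1 + 1/k\<close> and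
  a summand \<open>2 \<delta>\<close>.

  Cross terms: \<open>u j\<close> is nearly a top eigenvector of the \<open>j\<close>-th compression and \<open>c\<close> is orthogonal to
  it, so \<open>|u j \<bullet> M c| \<le> (\<gamma> + sqrt \<delta>) nu j 0 |c|\<close> (\<open>cross_term_le\<close>). This suffices as long as
  \<open>nu j 0\<close> is comparable to \<open>lam (q - 1)\<close>, but for early \<open>j\<close> it may be larger by the condition number.
  So cut at the last \<open>p < q\<close> with a gap \<open>lam p < (1 - G) lam (p - 1)\<close>. Since there are no gaps between
  \<open>p\<close> and \<open>q\<close>, \<open>lam p \<le> 2 lam (q - 1)\<close>. At a gap the vectors that are low for \<open>p\<close> are exactly
  \<open>e p, e (p + 1), \<dots>\<close>, so by the induction hypothesis the \<open>p\<close> vectors \<open>u 0, \<dots>, u (p - 1)\<close> nearly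
  exhaust the \<open>p\<close>-dimensional span of \<open>e 0, \<dots>, e (p - 1)\<close>, and whatever is orthogonal to them has
  little mass there (\<open>captured_top_mass\<close>). This bounds the cross terms with \<open>j < p\<close> by a multiple of
  \<open>sqrt (6 k \<delta>) lam 0\<close>, which the condition \<open>\<Delta> \<kappa>\<^sup>2 \<le> \<Gamma>\<^sup>2\<close> makes small, and \<open>nu j 0\<close> with \<open>j \<ge> p\<close>
  by \<open>3 lam (q - 1)\<close>.

  The argument loses only a polynomial factor in \<open>\<delta>\<close>: it needs \<open>\<delta> \<le> \<Delta> / (2^15 k^7)\<close>, which
  \<open>\<delta> = \<Delta> / k powr (44 ln k)\<close> satisfies for \<open>k \<ge> 2\<close>. For \<open>k = 1\<close> the conclusion follows
  directly from the guarantee of the single call.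
\<close>

section \<open>Orthonormal families\<close>

definition orthonormal_fam :: "nat \<Rightarrow> nat \<Rightarrow> (nat \<Rightarrow> real vec) \<Rightarrow> bool" where
  "orthonormal_fam d m u \<longleftrightarrow> (\<forall>i<m. u i \<in> carrier_vec d) \<and>
     (\<forall>i<m. \<forall>j<m. u i \<bullet> u j = (if i = j then 1 else 0))"

lemma scalar_prod_self_nonneg: "0 \<le> (x::real vec) \<bullet> x"
  by (simp add: scalar_prod_def sum_nonneg)

lemma scalar_prod_self_pos:
  assumes "(x::real vec) \<in> carrier_vec d" "x \<noteq> 0\<^sub>v d"
  shows "0 < x \<bullet> x"
proof -
  obtain i where "i < d" "x $ i \<noteq> 0" using assms by (metis carrier_vecD eq_vecI index_zero_vec)
  then show ?thesis using assms(1)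
    by (auto simp: scalar_prod_def intro!: sum_pos2[of _ i])
      (metis not_real_square_gt_zero)
qed

text \<open>The \<open>m\<close> vectors, padded with zero rows, form a singular square matrix; a kernel vector is the
  solution. It yields new directions for the spectral theorem, the min-max inequality \<open>lam_le_nu0\<close>, and the fact that no deflation
  projection vanishes.\<close>

lemma underdetermined_homogeneous:
  fixes w :: "nat \<Rightarrow> real vec"
  assumes "m < d" and w: "\<And>j. j < m \<Longrightarrow> w j \<in> carrier_vec d"
  shows "\<exists>x \<in> carrier_vec d. x \<bullet> x = 1 \<and> (\<forall>j<m. w j \<bullet> x = 0)"
proof -
  define A where "A = mat\<^sub>r d d (\<lambda>r. if r < m then w r else 0\<^sub>v d)"
  have A: "A \<in> carrier_mat d d" by (simp add: A_def)
  have rows: "row A r = (if r < m then w r else 0\<^sub>v d)" if "r < d" for r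
    using that w by (auto simp: A_def)
  have "A\<^sup>T *\<^sub>v unit_vec d m = 0\<^sub>v d"
    using A \<open>m < d\<close> rows[OF \<open>m < d\<close>] by (auto simp: mult_mat_vec_def scalar_prod_def)
      (intro eq_vecI, auto simp: scalar_prod_def A_def)
  moreover have "unit_vec d m \<noteq> (0\<^sub>v d :: real vec)"
    using \<open>m < d\<close> by (metis index_unit_vec(2) index_zero_vec(1) zero_neq_one)
  ultimately have "det A\<^sup>T = 0"
    using A det_0_iff_vec_prod_zero[of "A\<^sup>T" d] by (meson transpose_carrier_mat unit_vec_carrier)
  then have "det A = 0" using det_transpose[OF A] by simp
  then obtain v where v: "v \<in> carrier_vec d" "v \<noteq> 0\<^sub>v d" "A *\<^sub>v v = 0\<^sub>v d"
    using det_0_iff_vec_prod_zero[OF A] by auto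
  have orth: "w j \<bullet> v = 0" if "j < m" for j
  proof -
    have "(A *\<^sub>v v) $ j = row A j \<bullet> v" using A that \<open>m < d\<close> by auto
    then show ?thesis using v(3) rows[of j] that \<open>m < d\<close> by auto
  qed
  have pos: "0 < v \<bullet> v" by (rule scalar_prod_self_pos[OF v(1,2)])
  define x where "x = (1 / sqrt (v \<bullet> v)) \<cdot>\<^sub>v v"
  have "x \<in> carrier_vec d" using v by (simp add: x_def)
  moreover have "x \<bullet> x = 1" using pos v(1) by (simp add: x_def)
  moreover have "\<forall>j<m. w j \<bullet> x = 0" using orth v(1) w by (simp add: x_def)
  ultimately show ?thesis by blast
qed

lemma parseval:
  assumes e: "orthonormal_fam d d e" and x: "x \<in> carrier_vec d" and y: "y \<in> carrier_vec d"
  shows "x \<bullet> y = (\<Sum>l<d. (e l \<bullet> x) * (e l \<bullet> y))"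
proof -
  define E where "E = mat\<^sub>r d d e"
  have E: "E \<in> carrier_mat d d" by (simp add: E_def)
  have row: "row E l = e l" if "l < d" for l
    using that e by (auto simp: E_def orthonormal_fam_def)
  have "E * E\<^sup>T = 1\<^sub>m d"
    using e E by (intro eq_matI) (auto simp: row orthonormal_fam_def)
  then have inv: "E\<^sup>T * E = 1\<^sub>m d" using mat_mult_left_right_inverse[of E d "E\<^sup>T"] E by simp
  have "x \<bullet> y = x \<bullet> ((E\<^sup>T * E) *\<^sub>v y)" using inv y by simp
  also have "\<dots> = x \<bullet> (E\<^sup>T *\<^sub>v (E *\<^sub>v y))" using E y assoc_mult_mat_vec[of "E\<^sup>T" d d E d y] by simp
  also have "\<dots> = (E *\<^sub>v x) \<bullet> (E *\<^sub>v y)"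
    using transpose_vec_mult_scalar[of E d d x "E *\<^sub>v y"] E x y
    by (smt (verit) comm_scalar_prod mult_mat_vec_carrier transpose_carrier_mat)
  also have "\<dots> = (\<Sum>l<d. (e l \<bullet> x) * (e l \<bullet> y))"
    using E by (auto simp: scalar_prod_def[of "E *\<^sub>v x"] row atLeast0LessThan intro!: sum.cong)
  finally show ?thesis .
qed

text \<open>Together with \<open>vec_with_coords\<close> this makes vectors interchangeable with their coordinates in an
  orthonormal basis, which is how all later estimates are carried out.\<close>

lemma vec_eq_coords:
  assumes e: "orthonormal_fam d d e" and x: "x \<in> carrier_vec d" and y: "y \<in> carrier_vec d"
    and eq: "\<And>l. l < d \<Longrightarrow> e l \<bullet> x = e l \<bullet> y"
  shows "x = y"
proof (rule eq_vecI)
  fix i assume i: "i < dim_vec y"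
  have "unit_vec d i \<bullet> x = unit_vec d i \<bullet> y"
    using parseval[OF e, of "unit_vec d i"] x y eq by simp
  then show "x $ i = y $ i" using i x y by simp
qed (use x y in auto)

lemma vec_with_coords:
  assumes e: "orthonormal_fam d d e"
  shows "\<exists>x \<in> carrier_vec d. \<forall>l<d. e l \<bullet> x = c l"
proof -
  define E where "E = mat\<^sub>r d d e"
  have E: "E \<in> carrier_mat d d" by (simp add: E_def)
  have row: "row E l = e l" if "l < d" for l
    using that e by (auto simp: E_def orthonormal_fam_def)
  have inv: "E * E\<^sup>T = 1\<^sub>m d"
    using e E by (intro eq_matI) (auto simp: row orthonormal_fam_def)
  define x where "x = E\<^sup>T *\<^sub>v vec d c"
  have x: "x \<in> carrier_vec d" using E by (simp add: x_def)
  have "E *\<^sub>v x = vec d c"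
    unfolding x_def using assoc_mult_mat_vec[of E d d "E\<^sup>T" d "vec d c"] E inv by simp
  then have "e l \<bullet> x = c l" if "l < d" for l
    using that E row[OF that] by (metis carrier_matD(1) index_mult_mat_vec index_vec)
  with x show ?thesis by blast
qed

section \<open>The spectral theorem\<close>

text \<open>The dimension is a number and not a type here, so compactness of the unit sphere is obtained in the product
  topology on sequences that vanish from index \<open>d\<close> on.\<close>

lemma compact_unit_cube: "compact {x :: nat \<Rightarrow> real. (\<forall>i<d. \<bar>x i\<bar> \<le> 1) \<and> (\<forall>i\<ge>d. x i = 0)}"
proof -
  have "compactin (product_topology (\<lambda>i. euclidean) UNIV)
      (PiE UNIV (\<lambda>i::nat. if i < d then {-1..1} else {0::real}))"
    by (subst compactin_PiE) (auto simp: PiE_eq_empty_iff compactin_euclidean_iff)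
  moreover have "PiE UNIV (\<lambda>i::nat. if i < d then {-1..1} else {0::real})
      = {x. (\<forall>i<d. \<bar>x i\<bar> \<le> 1) \<and> (\<forall>i\<ge>d. x i = 0)}"
    by (auto simp: PiE_iff abs_le_iff split: if_splits)
  ultimately show ?thesis by (simp add: euclidean_product_topology compactin_euclidean_iff)
qed

definition vec_fun_of :: "real vec \<Rightarrow> nat \<Rightarrow> real" where
  "vec_fun_of x i = (if i < dim_vec x then x $ i else 0)"

lemma vec_fun_of_nth: "x \<in> carrier_vec d \<Longrightarrow> i < d \<Longrightarrow> vec_fun_of x i = x $ i"
  by (simp add: vec_fun_of_def)

lemma abs_nth_le_one:
  assumes "(x::real vec) \<in> carrier_vec d" "x \<bullet> x = 1" "i < d"
  shows "\<bar>x $ i\<bar> \<le> 1"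
proof -
  have "x $ i * x $ i \<le> (\<Sum>i<d. x $ i * x $ i)"
    using assms(3) by (intro member_le_sum) auto
  also have "\<dots> = 1" using assms by (simp add: scalar_prod_def atLeast0LessThan)
  finally show ?thesis by (simp add: abs_square_le_1 flip: power2_eq_square)
qed

lemma quadratic_form_sum:
  fixes A :: "real mat"
  assumes "A \<in> carrier_mat d d" "x \<in> carrier_vec d"
  shows "x \<bullet> (A *\<^sub>v x) = (\<Sum>i<d. x $ i * (\<Sum>j<d. A $$ (i, j) * x $ j))"
  using assms by (simp add: scalar_prod_def atLeast0LessThan row_def)

lemma rayleigh_max_exists:
  fixes A :: "real mat"
  assumes A: "A \<in> carrier_mat d d" and m: "m < d"
    and w: "\<And>j. j < m \<Longrightarrow> w j \<in> carrier_vec d"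
  shows "\<exists>v \<in> carrier_vec d. v \<bullet> v = 1 \<and> (\<forall>j<m. w j \<bullet> v = 0) \<and>
    (\<forall>x \<in> carrier_vec d. (\<forall>j<m. w j \<bullet> x = 0) \<longrightarrow> x \<bullet> (A *\<^sub>v x) \<le> (v \<bullet> (A *\<^sub>v v)) * (x \<bullet> x))"
proof -
  define C where "C = {x :: nat \<Rightarrow> real. (\<forall>i<d. \<bar>x i\<bar> \<le> 1) \<and> (\<forall>i\<ge>d. x i = 0)}"
  define S where "S = {x :: nat \<Rightarrow> real. (\<Sum>i<d. x i * x i) = 1} \<inter>
     (\<Inter>j\<in>{..<m}. {x. (\<Sum>i<d. w j $ i * x i) = 0})"
  define f where "f = (\<lambda>x :: nat \<Rightarrow> real. \<Sum>i<d. x i * (\<Sum>j<d. A $$ (i, j) * x j))"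
  have S: "closed S" unfolding S_def
    by (intro closed_Int closed_INT ballI closed_Collect_eq continuous_intros
        continuous_on_product_coordinates)
  have comp: "compact (C \<inter> S)"
    using compact_Int_closed[OF compact_unit_cube S] by (simp add: C_def)
  have inK: "vec_fun_of x \<in> C \<inter> S" and fx: "f (vec_fun_of x) = x \<bullet> (A *\<^sub>v x)"
    if x: "x \<in> carrier_vec d" "x \<bullet> x = 1" "\<forall>j<m. w j \<bullet> x = 0" for x
  proof -
    show "vec_fun_of x \<in> C \<inter> S"
      using x abs_nth_le_one[OF x(1,2)]
      by (auto simp: C_def S_def vec_fun_of_def scalar_prod_def atLeast0LessThan)
    show "f (vec_fun_of x) = x \<bullet> (A *\<^sub>v x)"
      using x(1) by (simp add: f_def vec_fun_of_nth[OF x(1)] quadratic_form_sum[OF A x(1)])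
  qed
  obtain x0 where "x0 \<in> carrier_vec d" "x0 \<bullet> x0 = 1" "\<forall>j<m. w j \<bullet> x0 = 0"
    using underdetermined_homogeneous[of m d w] m w by blast
  then have ne: "C \<inter> S \<noteq> {}" using inK by blast
  have "continuous_on (C \<inter> S) f" unfolding f_def
    by (intro continuous_intros continuous_on_subset[OF continuous_on_product_coordinates]) auto
  then obtain g where g: "g \<in> C \<inter> S" "\<And>y. y \<in> C \<inter> S \<Longrightarrow> f y \<le> f g"
    using continuous_attains_sup[OF comp ne] by blast
  define v where "v = vec d g"
  have v: "v \<in> carrier_vec d" by (simp add: v_def)
  have vg: "vec_fun_of v = g" using g(1) by (auto simp: C_def v_def vec_fun_of_def)
  have v1: "v \<bullet> v = 1" "\<forall>j<m. w j \<bullet> v = 0"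
    using g(1) by (auto simp: v_def S_def scalar_prod_def atLeast0LessThan)
  have max: "x \<bullet> (A *\<^sub>v x) \<le> (v \<bullet> (A *\<^sub>v v)) * (x \<bullet> x)"
    if x: "x \<in> carrier_vec d" "\<forall>j<m. w j \<bullet> x = 0" for x
  proof (cases "x = 0\<^sub>v d")
    case True
    then show ?thesis using A by simp
  next
    case False
    define r where "r = x \<bullet> x"
    have r: "0 < r" using scalar_prod_self_pos[OF x(1) False] by (simp add: r_def)
    define y where "y = (1 / sqrt r) \<cdot>\<^sub>v x"
    have y: "y \<in> carrier_vec d" "y \<bullet> y = 1" "\<forall>j<m. w j \<bullet> y = 0"
      using x r w by (auto simp: y_def r_def[symmetric])
    have "y \<bullet> (A *\<^sub>v y) \<le> v \<bullet> (A *\<^sub>v v)"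
      using g(2)[OF inK[OF y]] fx[OF y] fx[OF v v1] vg by simp
    moreover have "y \<bullet> (A *\<^sub>v y) = (x \<bullet> (A *\<^sub>v x)) / r"
      using x A r by (simp add: y_def mult_mat_vec[OF A x(1)])
    ultimately show ?thesis using r by (simp add: divide_le_eq r_def)
  qed
  show ?thesis using v v1 max by blast
qed

lemma symmetric_mat_scalar_prod:
  fixes A :: "real mat"
  assumes A: "A \<in> carrier_mat d d" "A\<^sup>T = A" and x: "x \<in> carrier_vec d" and y: "y \<in> carrier_vec d"
  shows "x \<bullet> (A *\<^sub>v y) = y \<bullet> (A *\<^sub>v x)"
  using transpose_vec_mult_scalar[OF A(1) y x] A(2) comm_scalar_prod[of x d "A *\<^sub>v y"]
    comm_scalar_prod[of y d "A *\<^sub>v x"] A(1) x y by (simp add: mult_mat_vec_carrier[OF A(1)])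

lemma compression_symmetric:
  fixes M :: "real mat"
  assumes "P \<in> carrier_mat d d" "P\<^sup>T = P" "M \<in> carrier_mat d d" "M\<^sup>T = M"
  shows "P * M * P \<in> carrier_mat d d" "(P * M * P)\<^sup>T = P * M * P"
  using assms transpose_mult[of "P * M" d d P d] transpose_mult[of P d d M d]
    assoc_mult_mat[of P d d M d P d] by auto

lemma linear_le_quadratic_imp_zero:
  assumes "\<And>t::real. 2 * t * a \<le> t\<^sup>2 * b"
  shows "a = (0::real)"
proof (rule ccontr)
  assume "a \<noteq> 0"
  define c where "c = \<bar>b\<bar> + 1"
  have c: "c > 0" "b < c" by (auto simp: c_def)
  have "2 * (a / c) * a \<le> (a / c)\<^sup>2 * b" by (rule assms)
  also have "\<dots> \<le> (a / c)\<^sup>2 * c" using c by (intro mult_left_mono) auto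
  also have "\<dots> = (a / c) * a" using c by (simp add: power2_eq_square)
  finally have "a * a / c \<le> 0" by simp
  then show False using \<open>a \<noteq> 0\<close> c
    by (metis divide_pos_pos linorder_not_less not_real_square_gt_zero)
qed

text \<open>First-order condition: moving from the maximiser \<open>v\<close> by \<open>t\<close> times the residual
  \<open>z = A v - \<nu> v\<close> changes the Rayleigh quotient by \<open>2 t |z|\<^sup>2\<close> to first order, so \<open>z = 0\<close>. The move
  is allowed because \<open>z\<close> is again orthogonal to the \<open>w j\<close>, these being eigenvectors.\<close>

lemma rayleigh_max_is_eigenvector:
  fixes A :: "real mat"
  assumes A: "A \<in> carrier_mat d d" "A\<^sup>T = A"
    and w: "\<And>j. j < m \<Longrightarrow> w j \<in> carrier_vec d" "\<And>j. j < m \<Longrightarrow> A *\<^sub>v w j = \<mu> j \<cdot>\<^sub>v w j"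
    and v: "v \<in> carrier_vec d" "v \<bullet> v = 1" "\<forall>j<m. w j \<bullet> v = 0"
    and max: "\<forall>x \<in> carrier_vec d. (\<forall>j<m. w j \<bullet> x = 0) \<longrightarrow>
       x \<bullet> (A *\<^sub>v x) \<le> (v \<bullet> (A *\<^sub>v v)) * (x \<bullet> x)"
  shows "A *\<^sub>v v = (v \<bullet> (A *\<^sub>v v)) \<cdot>\<^sub>v v"
proof -
  define \<nu> where "\<nu> = v \<bullet> (A *\<^sub>v v)"
  define z where "z = A *\<^sub>v v - \<nu> \<cdot>\<^sub>v v"
  have Av: "A *\<^sub>v v \<in> carrier_vec d" using A v by simp
  have z: "z \<in> carrier_vec d" using Av v by (simp add: z_def)
  have Az: "A *\<^sub>v z \<in> carrier_vec d" using A z by simp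
  have zorth: "w j \<bullet> z = 0" if j: "j < m" for j
  proof -
    have "w j \<bullet> (A *\<^sub>v v) = v \<bullet> (A *\<^sub>v w j)"
      by (rule symmetric_mat_scalar_prod[OF A w(1)[OF j] v(1)])
    also have "\<dots> = \<mu> j * (w j \<bullet> v)"
      using w(1)[OF j] v(1) comm_scalar_prod[of v d "w j"] by (simp add: w(2)[OF j])
    also have "\<dots> = 0" using v(3) j by simp
    finally have "w j \<bullet> (A *\<^sub>v v) = 0" .
    then show ?thesis unfolding z_def
      using scalar_prod_minus_distrib[of "w j" d "A *\<^sub>v v" "\<nu> \<cdot>\<^sub>v v"] w(1)[OF j] v j Av by simp
  qed
  define a where "a = z \<bullet> z"
  have va: "v \<bullet> (A *\<^sub>v z) - \<nu> * (v \<bullet> z) = a"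
  proof -
    have "v \<bullet> (A *\<^sub>v z) = z \<bullet> (A *\<^sub>v v)" by (rule symmetric_mat_scalar_prod[OF A v(1) z])
    moreover have "v \<bullet> z = z \<bullet> v" by (rule comm_scalar_prod[OF v(1) z])
    moreover have "z \<bullet> z = z \<bullet> (A *\<^sub>v v) - \<nu> * (z \<bullet> v)"
      using scalar_prod_minus_distrib[OF z Av, of "\<nu> \<cdot>\<^sub>v v"] v z by (simp flip: z_def)
    ultimately show ?thesis by (simp add: a_def)
  qed
  have "2 * t * a \<le> t\<^sup>2 * (\<nu> * a - z \<bullet> (A *\<^sub>v z))" for t
  proof -
    define x where "x = v + t \<cdot>\<^sub>v z"
    have x: "x \<in> carrier_vec d" using v z by (simp add: x_def)
    have "\<forall>j<m. w j \<bullet> x = 0"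
      using zorth v z w by (simp add: x_def scalar_prod_add_distrib[of _ d])
    then have le: "x \<bullet> (A *\<^sub>v x) \<le> \<nu> * (x \<bullet> x)" using max x by (simp add: \<nu>_def)
    have Ax: "A *\<^sub>v x = A *\<^sub>v v + t \<cdot>\<^sub>v (A *\<^sub>v z)"
      using A v z by (simp add: x_def mult_add_distrib_mat_vec mult_mat_vec)
    have "x \<bullet> (A *\<^sub>v x) = \<nu> + 2 * t * (v \<bullet> (A *\<^sub>v z)) + t\<^sup>2 * (z \<bullet> (A *\<^sub>v z))"
      using Av Az v z symmetric_mat_scalar_prod[OF A v(1) z] unfolding Ax
      by (simp add: x_def add_scalar_prod_distrib[of _ d] scalar_prod_add_distrib[of _ d]
          \<nu>_def power2_eq_square algebra_simps)
    moreover have "x \<bullet> x = 1 + 2 * t * (v \<bullet> z) + t\<^sup>2 * a"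
      using v z comm_scalar_prod[OF v(1) z]
      by (simp add: x_def add_scalar_prod_distrib[of _ d] scalar_prod_add_distrib[of _ d]
          a_def power2_eq_square algebra_simps)
    ultimately show ?thesis using le va by (simp add: algebra_simps)
  qed
  then have "a = 0" by (rule linear_le_quadratic_imp_zero)
  then have z0: "z = 0\<^sub>v d" using scalar_prod_self_pos[OF z] by (auto simp: a_def)
  have "A *\<^sub>v v = z + \<nu> \<cdot>\<^sub>v v" using A(1) v by (intro eq_vecI) (auto simp: z_def)
  also have "\<dots> = \<nu> \<cdot>\<^sub>v v" using z0 v by simp
  finally show ?thesis by (simp add: \<nu>_def)
qed

definition eigenbasis :: "nat \<Rightarrow> real mat \<Rightarrow> (nat \<Rightarrow> real vec) \<Rightarrow> (nat \<Rightarrow> real) \<Rightarrow> bool" where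
  "eigenbasis d A e lam \<longleftrightarrow> orthonormal_fam d d e \<and> (\<forall>l<d. A *\<^sub>v e l = lam l \<cdot>\<^sub>v e l) \<and>
     (\<forall>i j. i \<le> j \<longrightarrow> j < d \<longrightarrow> lam j \<le> lam i)"

text \<open>Eigenvectors are chosen greedily, each maximising the Rayleigh quotient on the complement of
  its predecessors. Successive maxima over shrinking subspaces decrease, so the eigenvalues come
  out sorted.\<close>

theorem spectral_theorem:
  fixes A :: "real mat"
  assumes A: "A \<in> carrier_mat d d" "A\<^sup>T = A"
  shows "\<exists>e lam. eigenbasis d A e lam"
proof -
  have "\<exists>e lam. orthonormal_fam d m e \<and> (\<forall>l<m. A *\<^sub>v e l = lam l \<cdot>\<^sub>v e l) \<and>
     (\<forall>l<m. \<forall>x\<in>carrier_vec d. (\<forall>j<l. e j \<bullet> x = 0) \<longrightarrow> x \<bullet> (A *\<^sub>v x) \<le> lam l * (x \<bullet> x))"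
    if "m \<le> d" for m
    using that
  proof (induction m)
    case 0
    then show ?case by (auto simp: orthonormal_fam_def)
  next
    case (Suc m)
    then obtain e lam where IH: "orthonormal_fam d m e" "\<forall>l<m. A *\<^sub>v e l = lam l \<cdot>\<^sub>v e l"
     "\<forall>l<m. \<forall>x\<in>carrier_vec d. (\<forall>j<l. e j \<bullet> x = 0) \<longrightarrow> x \<bullet> (A *\<^sub>v x) \<le> lam l * (x \<bullet> x)"
      by auto
    have ec: "e j \<in> carrier_vec d" if "j < m" for j using IH(1) that by (auto simp: orthonormal_fam_def)
    obtain v where v: "v \<in> carrier_vec d" "v \<bullet> v = 1" "\<forall>j<m. e j \<bullet> v = 0"
      and max: "\<forall>x \<in> carrier_vec d. (\<forall>j<m. e j \<bullet> x = 0) \<longrightarrow>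
         x \<bullet> (A *\<^sub>v x) \<le> (v \<bullet> (A *\<^sub>v v)) * (x \<bullet> x)"
      using rayleigh_max_exists[OF A(1), of m e] Suc.prems ec by auto
    have ev: "A *\<^sub>v v = (v \<bullet> (A *\<^sub>v v)) \<cdot>\<^sub>v v"
      using rayleigh_max_is_eigenvector[OF A ec _ v max] IH(2) by auto
    have v0: "v \<bullet> e j = 0" if "j < m" for j
      using v(1,3) that ec comm_scalar_prod[of v d "e j"] by simp
    show ?case
    proof (intro exI[of _ "e(m := v)"] exI[of _ "lam(m := v \<bullet> (A *\<^sub>v v))"] conjI)
      show "orthonormal_fam d (Suc m) (e(m := v))"
        using IH(1) v v0 by (auto simp: orthonormal_fam_def less_Suc_eq)
      show "\<forall>l<Suc m. A *\<^sub>v (e(m := v)) l = (lam(m := v \<bullet> (A *\<^sub>v v))) l \<cdot>\<^sub>v (e(m := v)) l"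
        using ev IH(2) by (auto simp: less_Suc_eq)
      show "\<forall>l<Suc m. \<forall>x\<in>carrier_vec d. (\<forall>j<l. (e(m := v)) j \<bullet> x = 0) \<longrightarrow>
          x \<bullet> (A *\<^sub>v x) \<le> (lam(m := v \<bullet> (A *\<^sub>v v))) l * (x \<bullet> x)"
        using IH(3) max by (auto simp: less_Suc_eq)
    qed
  qed
  from this[of d] obtain e lam where e: "orthonormal_fam d d e" "\<forall>l<d. A *\<^sub>v e l = lam l \<cdot>\<^sub>v e l"
     "\<forall>l<d. \<forall>x\<in>carrier_vec d. (\<forall>j<l. e j \<bullet> x = 0) \<longrightarrow> x \<bullet> (A *\<^sub>v x) \<le> lam l * (x \<bullet> x)"
    by auto
  have "lam j \<le> lam i" if ij: "i \<le> j" "j < d" for i j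
  proof -
    have "\<forall>l<i. e l \<bullet> e j = 0" using e(1) ij by (auto simp: orthonormal_fam_def)
    then have "e j \<bullet> (A *\<^sub>v e j) \<le> lam i * (e j \<bullet> e j)"
      using e(1) e(3)[rule_format, of i "e j"] ij by (simp add: orthonormal_fam_def)
    then show ?thesis using e(1,2) ij by (simp add: orthonormal_fam_def)
  qed
  then show ?thesis using e unfolding eigenbasis_def by blast
qed

section \<open>Eigenvalue lists and eigenspaces in an eigenbasis\<close>

lemma proots_prod_linear_factors:
  "proots (\<Prod>x\<leftarrow>xs. [:- x, 1:]) = mset (xs :: real list)"
proof (induction xs)
  case (Cons a xs)
  have "(\<Prod>x\<leftarrow>xs. [:- x, 1:]) \<noteq> 0" by (auto simp: prod_list_zero_iff)
  then show ?case using Cons proots_mult[of "[:- a, 1:]" "\<Prod>x\<leftarrow>xs. [:- x, 1:]"]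
    by (simp del: mult_pCons_left)
qed simp

lemma desc_linear_factors_unique:
  assumes "sorted_wrt (\<ge>) xs" "sorted_wrt (\<ge>) ys"
    and "(\<Prod>x\<leftarrow>xs. [:- x, 1:]) = (\<Prod>x\<leftarrow>ys. [:- x, 1:])"
  shows "xs = (ys :: real list)"
proof -
  have "mset (rev xs) = mset (rev ys)"
    using arg_cong[OF assms(3), of proots] by (simp add: proots_prod_linear_factors)
  moreover have "sorted (rev xs)" "sorted (rev ys)"
    using assms(1,2) by (simp_all add: sorted_wrt_rev)
  ultimately show ?thesis by (metis properties_for_sort rev_is_rev_conv)
qed

lemma char_poly_eigenbasis:
  assumes A: "A \<in> carrier_mat d d" and e: "eigenbasis d A e lam"
  shows "char_poly A = (\<Prod>x\<leftarrow>map lam [0..<d]. [:- x, 1:])"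
proof -
  define E where "E = mat\<^sub>r d d e"
  define D where "D = mat d d (\<lambda>(i, j). if i = j then lam i else 0)"
  have ec: "e l \<in> carrier_vec d" if "l < d" for l
    using e that by (auto simp: eigenbasis_def orthonormal_fam_def)
  have on: "e i \<bullet> e j = (if i = j then 1 else 0)" if "i < d" "j < d" for i j
    using e that by (auto simp: eigenbasis_def orthonormal_fam_def)
  have ev: "A *\<^sub>v e l = lam l \<cdot>\<^sub>v e l" if "l < d" for l
    using e that by (auto simp: eigenbasis_def)
  have E: "E \<in> carrier_mat d d" and D: "D \<in> carrier_mat d d" by (simp_all add: E_def D_def)
  have row: "row E l = e l" if "l < d" for l
    using that ec by (auto simp: E_def)
  have inv: "E * E\<^sup>T = 1\<^sub>m d"
    using E by (intro eq_matI) (auto simp: row on)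
  then have inv': "E\<^sup>T * E = 1\<^sub>m d" using mat_mult_left_right_inverse[of E d "E\<^sup>T"] E by simp
  \<comment> \<open>The rows of \<open>E\<close> are the eigenvectors, so conjugation by \<open>E\<close> diagonalises \<open>A\<close>.\<close>
  have "E * (A * E\<^sup>T) = D"
  proof (rule eq_matI)
    fix i j assume "i < dim_row D" "j < dim_col D"
    then have ij: "i < d" "j < d" using D by auto
    have "col (A * E\<^sup>T) j = A *\<^sub>v col E\<^sup>T j"
      by (rule col_mult2[OF A _ ij(2)]) (use E in simp)
    also have "col E\<^sup>T j = e j" using E ij row[OF ij(2)] by simp
    finally have "col (A * E\<^sup>T) j = A *\<^sub>v e j" .
    then show "(E * (A * E\<^sup>T)) $$ (i, j) = D $$ (i, j)"
      using ij A E ec[OF ij(1)] ec[OF ij(2)] by (simp add: row ev on D_def)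
  qed (use E D A in auto)
  then have "D = E * A * E\<^sup>T" using assoc_mult_mat[OF E A, of "E\<^sup>T" d] E by simp
  then have "similar_mat D A"
    using E A D inv inv' by (intro similar_matI[of D A E "E\<^sup>T" d]) auto
  then have "char_poly A = char_poly D" by (simp add: char_poly_similar)
  also have "\<dots> = (\<Prod>x\<leftarrow>diag_mat D. [:- x, 1:])"
    using D by (intro char_poly_upper_triangular) (auto simp: D_def upper_triangular_def)
  also have "diag_mat D = map lam [0..<d]" by (auto simp: diag_mat_def D_def)
  finally show ?thesis .
qed

lemma eigvals_desc_eigenbasis:
  assumes A: "A \<in> carrier_mat d d" and e: "eigenbasis d A e lam"
  shows "eigvals_desc A = map lam [0..<d]"
  unfolding eigvals_desc_def
proof (rule the_equality)
  have srt: "sorted_wrt (\<ge>) (map lam [0..<d])"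
    using e by (auto simp: eigenbasis_def sorted_wrt_map sorted_wrt_iff_nth_less)
  then show "sorted_wrt (\<ge>) (map lam [0..<d]) \<and>
      char_poly A = (\<Prod>x\<leftarrow>map lam [0..<d]. [:- x, 1:])"
    using char_poly_eigenbasis[OF A e] by simp
  fix xs assume xs: "sorted_wrt (\<ge>) xs \<and> char_poly A = (\<Prod>x\<leftarrow>xs. [:- x, 1:])"
  show "xs = map lam [0..<d]"
  proof (rule desc_linear_factors_unique[OF _ srt])
    show "sorted_wrt (\<ge>) xs" using xs by (rule conjunct1)
    show "(\<Prod>x\<leftarrow>xs. [:- x, 1:]) = (\<Prod>x\<leftarrow>map lam [0..<d]. [:- x, 1:])"
      using conjunct2[OF xs] char_poly_eigenbasis[OF A e] by (rule subst)
  qed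
qed

lemma eigval_eigenbasis:
  assumes "A \<in> carrier_mat d d" "eigenbasis d A e lam" "1 \<le> k" "k \<le> d"
  shows "eigval k A = lam (k - 1)"
  using assms by (simp add: eigval_def eigvals_desc_eigenbasis)

lemma col_span_eq:
  assumes "V \<in> carrier_mat d m"
  shows "col_span V = {V *\<^sub>v c | c. c \<in> carrier_vec m}"
proof -
  interpret vec_space "TYPE(real)" d .
  have "col_span V = col_space V" using assms by (simp add: col_span_def col_space_def)
  then show ?thesis using assms col_space_eq[OF assms] by auto
qed

definition eig_cols :: "nat \<Rightarrow> (nat \<Rightarrow> real vec) \<Rightarrow> (nat \<Rightarrow> real) \<Rightarrow> real \<Rightarrow> real mat" where
  "eig_cols d e lam \<tau> = mat_of_cols d (map e (filter (\<lambda>l. lam l < \<tau>) [0..<d]))"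

lemma bilinear_eigenbasis:
  assumes A: "A \<in> carrier_mat d d" "A\<^sup>T = A" and e: "eigenbasis d A e lam"
    and x: "x \<in> carrier_vec d" and l: "l < d"
  shows "e l \<bullet> (A *\<^sub>v x) = lam l * (e l \<bullet> x)"
proof -
  have el: "e l \<in> carrier_vec d" "A *\<^sub>v e l = lam l \<cdot>\<^sub>v e l"
    using e l by (auto simp: eigenbasis_def orthonormal_fam_def)
  have "e l \<bullet> (A *\<^sub>v x) = x \<bullet> (A *\<^sub>v e l)"
    by (rule symmetric_mat_scalar_prod[OF A el(1) x])
  also have "\<dots> = lam l * (e l \<bullet> x)" using el x comm_scalar_prod[of x d "e l"] by simp
  finally show ?thesis .
qed

lemma eigspace_less_eq_col_span:
  assumes A: "A \<in> carrier_mat d d" "A\<^sup>T = A" and e: "eigenbasis d A e lam"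
  shows "eigspace_less \<tau> A = col_span (eig_cols d e lam \<tau>)"
proof -
  interpret vec_space "TYPE(real)" d .
  define S where "S = {v. \<exists>\<mu><\<tau>. eigenvector A v \<mu>}"
  define ls where "ls = filter (\<lambda>l. lam l < \<tau>) [0..<d]"
  have E: "eig_cols d e lam \<tau> = mat_of_cols d (map e ls)" by (simp add: eig_cols_def ls_def)
  have on: "orthonormal_fam d d e" using e by (simp add: eigenbasis_def)
  have ec: "e l \<in> carrier_vec d" if "l < d" for l
    using on that by (auto simp: orthonormal_fam_def)
  have lsd: "l < d" "lam l < \<tau>" if "l \<in> set ls" for l using that by (auto simp: ls_def)
  have cols: "cols (mat_of_cols d (map e ls)) = map e ls"
    using lsd ec by (intro cols_mat_of_cols) auto
  have Sc: "S \<subseteq> carrier_vec d" using A by (auto simp: S_def eigenvector_def)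
  have "set (map e ls) \<subseteq> S"
  proof
    fix v assume "v \<in> set (map e ls)"
    then obtain l where l: "l \<in> set ls" "v = e l" by auto
    have "e l \<bullet> e l = 1" using on lsd[OF l(1)] by (auto simp: orthonormal_fam_def)
    then have "e l \<noteq> 0\<^sub>v d" using ec[OF lsd(1)[OF l(1)]] by auto
    then have "eigenvector A (e l) (lam l)"
      using A e ec lsd[OF l(1)] by (auto simp: eigenvector_def eigenbasis_def)
    then show "v \<in> S" using lsd[OF l(1)] l by (auto simp: S_def)
  qed
  then have "span (set (map e ls)) \<subseteq> span S" by (rule span_is_monotone)
  moreover have "S \<subseteq> span (set (map e ls))"
  proof
    fix v assume "v \<in> S"
    then obtain \<mu> where mu: "\<mu> < \<tau>" "eigenvector A v \<mu>" by (auto simp: S_def)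
    then have v: "v \<in> carrier_vec d" "A *\<^sub>v v = \<mu> \<cdot>\<^sub>v v" using A by (auto simp: eigenvector_def)
    have zero: "e l \<bullet> v = 0" if l: "l < d" "\<not> lam l < \<tau>" for l
    proof -
      have "lam l * (e l \<bullet> v) = e l \<bullet> (A *\<^sub>v v)" using bilinear_eigenbasis[OF A e v(1) l(1)] by simp
      also have "\<dots> = \<mu> * (e l \<bullet> v)" using v ec[OF l(1)] by simp
      finally show ?thesis using mu(1) l(2) by auto
    qed
    define E0 where "E0 = mat_of_cols d (map e ls)"
    have E0: "E0 \<in> carrier_mat d (length ls)" unfolding E0_def by (rule carrier_matI) auto
    define c where "c = vec (length ls) (\<lambda>i. e (ls ! i) \<bullet> v)"
    have c: "c \<in> carrier_vec (length ls)" by (simp add: c_def)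
    have "v = E0 *\<^sub>v c"
    proof (rule vec_eq_coords[OF on v(1)])
      show "E0 *\<^sub>v c \<in> carrier_vec d" using E0 c by simp
      fix l assume l: "l < d"
      have "e l \<bullet> (E0 *\<^sub>v c) = (E0\<^sup>T *\<^sub>v e l) \<bullet> c"
        using transpose_vec_mult_scalar[OF E0 c ec[OF l]] by simp
      also have "\<dots> = (\<Sum>i<length ls. (E0\<^sup>T *\<^sub>v e l) $ i * c $ i)"
        using c by (simp add: scalar_prod_def atLeast0LessThan)
      also have "\<dots> = (\<Sum>i<length ls. (e (ls ! i) \<bullet> e l) * (e (ls ! i) \<bullet> v))"
      proof (intro sum.cong refl)
        fix i assume i: "i \<in> {..<length ls}"
        then have "col E0 i = e (ls ! i)" using lsd ec by (simp add: E0_def)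
        then show "(E0\<^sup>T *\<^sub>v e l) $ i * c $ i = (e (ls ! i) \<bullet> e l) * (e (ls ! i) \<bullet> v)"
          using i E0 by (simp add: c_def)
      qed
      also have "\<dots> = (\<Sum>x\<leftarrow>ls. (e x \<bullet> e l) * (e x \<bullet> v))"
        by (simp add: sum_list_sum_nth atLeast0LessThan)
      also have "\<dots> = (\<Sum>x\<in>set ls. (e x \<bullet> e l) * (e x \<bullet> v))"
        by (rule sum_list_distinct_conv_sum_set) (simp add: ls_def)
      also have "\<dots> = (\<Sum>x\<in>set ls. if x = l then e l \<bullet> v else 0)"
        using on l lsd by (intro sum.cong) (auto simp: orthonormal_fam_def)
      also have "\<dots> = e l \<bullet> v" using zero[OF l] l by (auto simp: ls_def)
      finally show "e l \<bullet> v = e l \<bullet> (E0 *\<^sub>v c)" by simp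
    qed
    then have "v \<in> col_span E0" using c col_span_eq[OF E0] by auto
    then show "v \<in> span (set (map e ls))" using E0 cols by (simp add: col_span_def E0_def)
  qed
  then have "span S \<subseteq> span (set (map e ls))"
    using span_subsetI[of "set (map e ls)" S] ec lsd by auto
  ultimately have "span S = span (set (map e ls))" by blast
  then show ?thesis
    using A cols unfolding E by (simp add: eigspace_less_def col_span_def S_def)
qed

text \<open>Both sides are the squared norm of an orthogonal projection of \<open>u\<close>. The projection \<open>V c\<close> with
  \<open>c = V\<^sup>T u\<close> can be written \<open>W b\<close> with \<open>|b| = |c|\<close>, and \<open>|c|\<^sup>2 = u \<bullet> W b = (W\<^sup>T u) \<bullet> b\<close>;
  Cauchy-Schwarz finishes. Applied in both directions it shows that the choice of
  the basis of an eigenspace is immaterial.\<close>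

lemma orthonormal_cols_norm_le:
  assumes V: "V \<in> carrier_mat d m" "orthonormal_cols V" and W: "W \<in> carrier_mat d n" "orthonormal_cols W"
    and sub: "col_span V \<subseteq> col_span W" and u: "u \<in> carrier_vec d"
  shows "(V\<^sup>T *\<^sub>v u) \<bullet> (V\<^sup>T *\<^sub>v u) \<le> (W\<^sup>T *\<^sub>v u) \<bullet> (W\<^sup>T *\<^sub>v u)"
proof -
  define c where "c = V\<^sup>T *\<^sub>v u"
  have c: "c \<in> carrier_vec m" using V u by (simp add: c_def)
  have "V *\<^sub>v c \<in> col_span W" using sub c col_span_eq[OF V(1)] by auto
  then obtain b where b: "b \<in> carrier_vec n" "V *\<^sub>v c = W *\<^sub>v b" using col_span_eq[OF W(1)] by auto
  have id: "(X *\<^sub>v z) \<bullet> (X *\<^sub>v z) = z \<bullet> z"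
    if X: "X \<in> carrier_mat d r" "orthonormal_cols X" and z: "z \<in> carrier_vec r" for X r z
  proof -
    have "(X *\<^sub>v z) \<bullet> (X *\<^sub>v z) = (X\<^sup>T *\<^sub>v (X *\<^sub>v z)) \<bullet> z"
      using transpose_vec_mult_scalar[OF X(1) z, of "X *\<^sub>v z"] X z by simp
    also have "X\<^sup>T *\<^sub>v (X *\<^sub>v z) = (X\<^sup>T * X) *\<^sub>v z" using X z by simp
    also have "\<dots> = z" using X z by (simp add: orthonormal_cols_def)
    finally show ?thesis .
  qed
  have cb: "c \<bullet> c = b \<bullet> b" using id[OF V c] id[OF W b(1)] b(2) by simp
  define a where "a = W\<^sup>T *\<^sub>v u"
  have a: "a \<in> carrier_vec n" using W u by (simp add: a_def)
  have "c \<bullet> c = u \<bullet> (V *\<^sub>v c)"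
    unfolding c_def[symmetric] using transpose_vec_mult_scalar[OF V(1) c u] by (simp add: c_def)
  also have "\<dots> = a \<bullet> b" using transpose_vec_mult_scalar[OF W(1) b(1) u] b(2) by (simp add: a_def)
  finally have cab: "c \<bullet> c = a \<bullet> b" .
  have "0 \<le> (a - b) \<bullet> (a - b)" by (rule scalar_prod_self_nonneg)
  also have "\<dots> = a \<bullet> a - 2 * (a \<bullet> b) + b \<bullet> b"
    using a b(1) comm_scalar_prod[of a n b]
    by (simp add: minus_scalar_prod_distrib[of _ n] scalar_prod_minus_distrib[of _ n])
  finally show ?thesis using cab cb by (simp add: a_def c_def)
qed

lemma frob_norm_transpose_mult:
  assumes V: "V \<in> carrier_mat d m" and U: "U \<in> carrier_mat d k"
  shows "(frob_norm (V\<^sup>T * U))\<^sup>2 = (\<Sum>j<k. (V\<^sup>T *\<^sub>v col U j) \<bullet> (V\<^sup>T *\<^sub>v col U j))"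
proof -
  have "(frob_norm (V\<^sup>T * U))\<^sup>2 = (\<Sum>i<m. \<Sum>j<k. ((V\<^sup>T * U) $$ (i, j))\<^sup>2)"
    using V U by (simp add: frob_norm_def sum_nonneg)
  also have "\<dots> = (\<Sum>j<k. \<Sum>i<m. ((V\<^sup>T * U) $$ (i, j))\<^sup>2)" by (rule sum.swap)
  also have "\<dots> = (\<Sum>j<k. (V\<^sup>T *\<^sub>v col U j) \<bullet> (V\<^sup>T *\<^sub>v col U j))"
    using V U by (intro sum.cong) (auto simp: scalar_prod_def atLeast0LessThan power2_eq_square)
  finally show ?thesis .
qed

lemma frob_norm_V_less:
  assumes A: "A \<in> carrier_mat d d" "A\<^sup>T = A" and e: "eigenbasis d A e lam"
    and U: "U \<in> carrier_mat d k"
  shows "(frob_norm ((V_less \<tau> A)\<^sup>T * U))\<^sup>2 =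
    (\<Sum>j<k. \<Sum>l | l < d \<and> lam l < \<tau>. (e l \<bullet> col U j)\<^sup>2)"
proof -
  define ls where "ls = filter (\<lambda>l. lam l < \<tau>) [0..<d]"
  define W where "W = eig_cols d e lam \<tau>"
  have W_eq: "W = mat_of_cols d (map e ls)" by (simp add: W_def eig_cols_def ls_def)
  have on: "orthonormal_fam d d e" using e by (simp add: eigenbasis_def)
  have ec: "e l \<in> carrier_vec d" if "l < d" for l
    using on that by (auto simp: orthonormal_fam_def)
  have lsd: "ls ! i < d" if "i < length ls" for i using nth_mem[OF that] by (auto simp: ls_def)
  have W: "W \<in> carrier_mat d (length ls)" unfolding W_eq by (rule carrier_matI) auto
  have colW: "col W i = e (ls ! i)" if "i < length ls" for i
    using that ec[OF lsd[OF that]] by (simp add: W_eq)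
  have "distinct ls" by (simp add: ls_def)
  then have Wo: "orthonormal_cols W"
    unfolding orthonormal_cols_def using W on lsd
    by (intro eq_matI) (auto simp: colW orthonormal_fam_def nth_eq_iff_index_eq)
  have sp: "col_span W = eigspace_less \<tau> A"
    using eigspace_less_eq_col_span[OF A e] by (simp add: W_def)
  define V where "V = V_less \<tau> A"
  have "dim_row V = dim_row A \<and> orthonormal_cols V \<and> col_span V = eigspace_less \<tau> A"
    unfolding V_def V_less_def
    by (rule someI[of _ W]) (use W Wo sp A in auto)
  then have V: "V \<in> carrier_mat d (dim_col V)" "orthonormal_cols V" "col_span V = col_span W"
    using A sp by auto
  have "(frob_norm (V\<^sup>T * U))\<^sup>2 = (\<Sum>j<k. (V\<^sup>T *\<^sub>v col U j) \<bullet> (V\<^sup>T *\<^sub>v col U j))"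
    by (rule frob_norm_transpose_mult[OF V(1) U])
  also have "\<dots> = (\<Sum>j<k. (W\<^sup>T *\<^sub>v col U j) \<bullet> (W\<^sup>T *\<^sub>v col U j))"
  proof (intro sum.cong refl antisym)
    fix j assume "j \<in> {..<k}"
    then have u: "col U j \<in> carrier_vec d" using U by auto
    show "(V\<^sup>T *\<^sub>v col U j) \<bullet> (V\<^sup>T *\<^sub>v col U j) \<le> (W\<^sup>T *\<^sub>v col U j) \<bullet> (W\<^sup>T *\<^sub>v col U j)"
      by (rule orthonormal_cols_norm_le[OF V(1,2) W Wo _ u]) (use V in simp)
    show "(W\<^sup>T *\<^sub>v col U j) \<bullet> (W\<^sup>T *\<^sub>v col U j) \<le> (V\<^sup>T *\<^sub>v col U j) \<bullet> (V\<^sup>T *\<^sub>v col U j)"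
      by (rule orthonormal_cols_norm_le[OF W Wo V(1,2) _ u]) (use V in simp)
  qed
  also have "\<dots> = (\<Sum>j<k. \<Sum>l | l < d \<and> lam l < \<tau>. (e l \<bullet> col U j)\<^sup>2)"
  proof (intro sum.cong refl)
    fix j assume "j \<in> {..<k}"
    have "(W\<^sup>T *\<^sub>v col U j) \<bullet> (W\<^sup>T *\<^sub>v col U j) = (\<Sum>i<length ls. (e (ls ! i) \<bullet> col U j)\<^sup>2)"
      using W by (auto simp: scalar_prod_def[of "W\<^sup>T *\<^sub>v col U j"] colW atLeast0LessThan
          power2_eq_square intro!: sum.cong)
    also have "\<dots> = (\<Sum>l\<leftarrow>ls. (e l \<bullet> col U j)\<^sup>2)" by (simp add: sum_list_sum_nth atLeast0LessThan)
    also have "\<dots> = (\<Sum>l\<in>set ls. (e l \<bullet> col U j)\<^sup>2)"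
      by (rule sum_list_distinct_conv_sum_set[OF \<open>distinct ls\<close>])
    also have "set ls = {l. l < d \<and> lam l < \<tau>}" by (auto simp: ls_def)
    finally show "(W\<^sup>T *\<^sub>v col U j) \<bullet> (W\<^sup>T *\<^sub>v col U j) = (\<Sum>l | l < d \<and> lam l < \<tau>. (e l \<bullet> col U j)\<^sup>2)" .
  qed
  finally show ?thesis by (simp add: V_def)
qed

section \<open>Norms of coordinate vectors\<close>

lemma eigenbasis_quadratic:
  assumes A: "A \<in> carrier_mat d d" "A\<^sup>T = A" and e: "eigenbasis d A e lam"
    and x: "x \<in> carrier_vec d" and y: "y \<in> carrier_vec d"
  shows "x \<bullet> (A *\<^sub>v y) = (\<Sum>l<d. lam l * (e l \<bullet> x) * (e l \<bullet> y))"
proof -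
  have on: "orthonormal_fam d d e" using e by (simp add: eigenbasis_def)
  have "x \<bullet> (A *\<^sub>v y) = (\<Sum>l<d. (e l \<bullet> x) * (e l \<bullet> (A *\<^sub>v y)))"
    using A y by (intro parseval[OF on x]) auto
  also have "\<dots> = (\<Sum>l<d. lam l * (e l \<bullet> x) * (e l \<bullet> y))"
    by (intro sum.cong) (auto simp: bilinear_eigenbasis[OF A e y])
  finally show ?thesis .
qed

lemma parseval_L2:
  assumes "orthonormal_fam d d e" "x \<in> carrier_vec d"
  shows "L2_set (\<lambda>l. e l \<bullet> x) {..<d} = sqrt (x \<bullet> x)"
  using parseval[OF assms assms(2)] by (simp add: L2_set_def power2_eq_square)

lemma L2_set_subset: "finite B \<Longrightarrow> A \<subseteq> B \<Longrightarrow> L2_set f A \<le> L2_set f B"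
  unfolding L2_set_def by (intro real_sqrt_le_mono sum_mono2) auto

lemma L2_set_coords_le:
  assumes "orthonormal_fam d d e" "x \<in> carrier_vec d" "S \<subseteq> {..<d}"
  shows "L2_set (\<lambda>l. e l \<bullet> x) S \<le> sqrt (x \<bullet> x)"
  using L2_set_subset[OF _ assms(3)] parseval_L2[OF assms(1,2)] by (metis finite_lessThan)

lemma sum_abs_mult_le_L2:
  assumes "\<And>i. i \<in> A \<Longrightarrow> \<bar>c i\<bar> \<le> b" "0 \<le> b"
  shows "\<bar>\<Sum>i\<in>A. c i * f i * g i\<bar> \<le> b * (L2_set f A * L2_set g A)"
proof -
  have "\<bar>\<Sum>i\<in>A. c i * f i * g i\<bar> \<le> (\<Sum>i\<in>A. \<bar>c i\<bar> * (\<bar>f i\<bar> * \<bar>g i\<bar>))"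
    by (rule order_trans[OF sum_abs]) (simp add: abs_mult mult.assoc)
  also have "\<dots> \<le> (\<Sum>i\<in>A. b * (\<bar>f i\<bar> * \<bar>g i\<bar>))"
    using assms by (intro sum_mono mult_right_mono) auto
  also have "\<dots> = b * (\<Sum>i\<in>A. \<bar>f i\<bar> * \<bar>g i\<bar>)" by (simp add: sum_distrib_left)
  also have "\<dots> \<le> b * (L2_set f A * L2_set g A)"
    using assms(2) by (intro mult_left_mono L2_set_mult_ineq)
  finally show ?thesis .
qed

lemma L2_set_sum_le: "L2_set (\<lambda>l. \<Sum>j\<in>J. g j l) S \<le> (\<Sum>j\<in>J. L2_set (g j) S)"
proof (induction J rule: infinite_finite_induct)
  case (insert j J)
  then show ?case using L2_set_triangle_ineq[of "g j" "\<lambda>l. \<Sum>j\<in>J. g j l" S] by simp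
qed (simp_all add: L2_set_def)

section \<open>Geometry of a deflation run\<close>

text \<open>A run of \<open>k\<close> deflation steps, in coordinates: \<open>e, lam\<close> is an eigenbasis of \<open>M\<close>, and
  \<open>f i, nu i\<close> one of the \<open>i\<close>-th compression. The projections are described by their bilinear
  form, and the guarantee of each step by the mass of \<open>u i\<close> on the small eigenvalues
  of its compression.\<close>

locale deflation =
  fixes d k :: nat and M :: "real mat" and e :: "nat \<Rightarrow> real vec" and lam :: "nat \<Rightarrow> real"
    and u :: "nat \<Rightarrow> real vec" and P :: "nat \<Rightarrow> real mat"
    and f :: "nat \<Rightarrow> nat \<Rightarrow> real vec" and nu :: "nat \<Rightarrow> nat \<Rightarrow> real"
    and \<delta> \<gamma> :: real
  assumes k_le: "k \<le> d"
    and M: "M \<in> carrier_mat d d" "M\<^sup>T = M"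
    and eb: "eigenbasis d M e lam"
    and lam_nonneg: "\<And>l. l < d \<Longrightarrow> 0 \<le> lam l"
    and onu: "orthonormal_fam d k u"
    and P: "\<And>i. i \<le> k \<Longrightarrow> P i \<in> carrier_mat d d" "\<And>i. i \<le> k \<Longrightarrow> (P i)\<^sup>T = P i"
    and P_form: "\<And>i x y. i \<le> k \<Longrightarrow> x \<in> carrier_vec d \<Longrightarrow> y \<in> carrier_vec d \<Longrightarrow>
        y \<bullet> (P i *\<^sub>v x) = y \<bullet> x - (\<Sum>j<i. (u j \<bullet> y) * (u j \<bullet> x))"
    and fb: "\<And>i. i < k \<Longrightarrow> eigenbasis d (P i * M * P i) (f i) (nu i)"
    and low_mass: "\<And>i. i < k \<Longrightarrow> (\<Sum>l | l < d \<and> nu i l < (1 - \<gamma>) * nu i 0. (f i l \<bullet> u i)\<^sup>2) \<le> \<delta>"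
    and \<gamma>: "0 \<le> \<gamma>" "\<gamma> < 1" and \<delta>: "0 \<le> \<delta>"
begin

abbreviation orth_prefix :: "nat \<Rightarrow> real vec \<Rightarrow> bool" where
  "orth_prefix i x \<equiv> x \<in> carrier_vec d \<and> (\<forall>j<i. u j \<bullet> x = 0)"

lemma e_on: "orthonormal_fam d d e" using eb by (simp add: eigenbasis_def)
lemma f_on: "i < k \<Longrightarrow> orthonormal_fam d d (f i)" using fb by (simp add: eigenbasis_def)
lemma e_carrier: "l < d \<Longrightarrow> e l \<in> carrier_vec d" using e_on by (simp add: orthonormal_fam_def)
lemma f_carrier: "i < k \<Longrightarrow> l < d \<Longrightarrow> f i l \<in> carrier_vec d"
  using f_on by (simp add: orthonormal_fam_def)
lemma u_carrier: "j < k \<Longrightarrow> u j \<in> carrier_vec d" using onu by (simp add: orthonormal_fam_def)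
lemma lam_antimono: "i \<le> j \<Longrightarrow> j < d \<Longrightarrow> lam j \<le> lam i" using eb by (simp add: eigenbasis_def)
lemma nu_antimono: "i < k \<Longrightarrow> l \<le> m \<Longrightarrow> m < d \<Longrightarrow> nu i m \<le> nu i l"
  using fb by (simp add: eigenbasis_def)
lemma u_orth_prefix: "i < k \<Longrightarrow> orth_prefix i (u i)"
  using onu by (auto simp: orthonormal_fam_def)

lemma compress_carrier: "i < k \<Longrightarrow> P i * M * P i \<in> carrier_mat d d"
  using compression_symmetric(1)[OF P M, of i] by simp

lemma compress_symmetric: "i < k \<Longrightarrow> (P i * M * P i)\<^sup>T = P i * M * P i"
  using compression_symmetric(2)[OF P M, of i] by simp

lemma compress_vec:
  "i < k \<Longrightarrow> x \<in> carrier_vec d \<Longrightarrow> (P i * M * P i) *\<^sub>v x = P i *\<^sub>v (M *\<^sub>v (P i *\<^sub>v x))"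
  using P(1)[of i] M assoc_mult_mat_vec[of "P i * M" d d "P i" d x]
    assoc_mult_mat_vec[of "P i" d d M d "P i *\<^sub>v x"] by simp

lemma P_vec: "i \<le> k \<Longrightarrow> x \<in> carrier_vec d \<Longrightarrow> P i *\<^sub>v x \<in> carrier_vec d"
  by (rule mult_mat_vec_carrier[OF P(1)])

lemma P_fix:
  assumes i: "i \<le> k" and x: "orth_prefix i x"
  shows "P i *\<^sub>v x = x"
proof (rule vec_eq_coords[OF e_on])
  fix l assume "l < d"
  then show "e l \<bullet> (P i *\<^sub>v x) = e l \<bullet> x" using P_form[OF i _ e_carrier, of x l] x by simp
qed (use i x P_vec in auto)

lemma P_self: "i \<le> k \<Longrightarrow> x \<in> carrier_vec d \<Longrightarrow> y \<in> carrier_vec d \<Longrightarrow>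
  x \<bullet> (P i *\<^sub>v y) = (P i *\<^sub>v x) \<bullet> y"
  using transpose_vec_mult_scalar[OF P(1), of i y x] P(2)[of i] by simp

lemma u_P_zero:
  assumes i: "i \<le> k" and j: "j < i" and x: "x \<in> carrier_vec d"
  shows "u j \<bullet> (P i *\<^sub>v x) = 0"
proof -
  have jk: "j < k" using i j by simp
  have "(\<Sum>j'<i. (u j' \<bullet> u j) * (u j' \<bullet> x)) = (\<Sum>j'<i. if j' = j then u j \<bullet> x else 0)"
    using onu i jk by (intro sum.cong) (auto simp: orthonormal_fam_def)
  also have "\<dots> = u j \<bullet> x" using j by simp
  finally show ?thesis using P_form[OF i x u_carrier[OF jk]] by simp
qed

lemma P_orth_prefix: "i \<le> k \<Longrightarrow> x \<in> carrier_vec d \<Longrightarrow> orth_prefix i (P i *\<^sub>v x)"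
  using u_P_zero P_vec by blast

lemma P_norm:
  assumes i: "i \<le> k" and x: "x \<in> carrier_vec d"
  shows "(P i *\<^sub>v x) \<bullet> (P i *\<^sub>v x) = x \<bullet> x - (\<Sum>j<i. (u j \<bullet> x)\<^sup>2)"
proof -
  have "(P i *\<^sub>v x) \<bullet> (P i *\<^sub>v x) = x \<bullet> (P i *\<^sub>v (P i *\<^sub>v x))"
    by (rule P_self[symmetric, OF i x P_vec[OF i x]])
  also have "\<dots> = x \<bullet> (P i *\<^sub>v x)" using P_fix[OF i P_orth_prefix[OF i x]] by simp
  finally show ?thesis using P_form[OF i x x] by (simp add: power2_eq_square)
qed

lemma compress_eq_on_prefix:
  assumes i: "i < k" and x: "orth_prefix i x" and y: "orth_prefix i y"
  shows "x \<bullet> ((P i * M * P i) *\<^sub>v y) = x \<bullet> (M *\<^sub>v y)"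
proof -
  have "x \<bullet> ((P i * M * P i) *\<^sub>v y) = x \<bullet> (P i *\<^sub>v (M *\<^sub>v y))"
    using i y P_fix[of i y] by (simp add: compress_vec)
  also have "\<dots> = (P i *\<^sub>v x) \<bullet> (M *\<^sub>v y)"
    using i x y M by (intro P_self) auto
  finally show ?thesis using i x P_fix[of i x] by simp
qed

lemma rayleigh_le_nu0:
  assumes i: "i < k" and x: "orth_prefix i x"
  shows "x \<bullet> (M *\<^sub>v x) \<le> nu i 0 * (x \<bullet> x)"
proof -
  have "x \<bullet> (M *\<^sub>v x) = (\<Sum>l<d. nu i l * (f i l \<bullet> x) * (f i l \<bullet> x))"
    using compress_eq_on_prefix[OF i x x]
      eigenbasis_quadratic[OF compress_carrier[OF i] compress_symmetric[OF i] fb[OF i]] x by simp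
  also have "\<dots> \<le> (\<Sum>l<d. nu i 0 * ((f i l \<bullet> x) * (f i l \<bullet> x)))"
    using nu_antimono[OF i, of 0] unfolding mult.assoc by (intro sum_mono mult_right_mono) auto
  also have "\<dots> = nu i 0 * (x \<bullet> x)" using parseval[OF f_on[OF i], of x x] x by (simp add: sum_distrib_left)
  finally show ?thesis .
qed

lemma nu_eq_rayleigh:
  assumes i: "i < k" and l: "l < d"
  shows "nu i l = (P i *\<^sub>v f i l) \<bullet> (M *\<^sub>v (P i *\<^sub>v f i l))"
proof -
  have fl: "f i l \<in> carrier_vec d" using f_carrier i l by simp
  have "nu i l = f i l \<bullet> ((P i * M * P i) *\<^sub>v f i l)"
    using fb[OF i] l by (simp add: eigenbasis_def orthonormal_fam_def)
  also have "\<dots> = (P i *\<^sub>v f i l) \<bullet> (M *\<^sub>v (P i *\<^sub>v f i l))"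
    using fl i M P_vec[of i "f i l"] by (simp add: compress_vec P_self)
  finally show ?thesis .
qed

lemma M_quadratic:
  "x \<in> carrier_vec d \<Longrightarrow> y \<in> carrier_vec d \<Longrightarrow>
    x \<bullet> (M *\<^sub>v y) = (\<Sum>l<d. lam l * (e l \<bullet> x) * (e l \<bullet> y))"
  by (rule eigenbasis_quadratic[OF M eb])

lemma nu_nonneg:
  assumes i: "i < k" and l: "l < d"
  shows "0 \<le> nu i l"
proof -
  have x: "P i *\<^sub>v f i l \<in> carrier_vec d" using P_vec[of i] f_carrier[OF i l] i by simp
  show ?thesis unfolding nu_eq_rayleigh[OF i l] M_quadratic[OF x x] mult.assoc
    by (intro sum_nonneg mult_nonneg_nonneg[OF lam_nonneg] zero_le_square) auto
qed

text \<open>Min-max: the span of \<open>e 0, \<dots>, e i\<close> has dimension \<open>i + 1\<close> and so contains a unit vector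
  orthogonal to \<open>u 0, \<dots>, u (i - 1)\<close>.\<close>

lemma lam_le_nu0:
  assumes i: "i < k"
  shows "lam i \<le> nu i 0"
proof -
  have id: "i < d" using i k_le by simp
  \<comment> \<open>\<open>i\<close> conditions from the \<open>u j\<close> and \<open>d - 1 - i\<close> from \<open>e (i + 1), \<dots>, e (d - 1)\<close>.\<close>
  define w where "w = (\<lambda>j. if j < i then u j else e (Suc j))"
  have wc: "w j \<in> carrier_vec d" if "j < d - 1" for j
    using that i u_carrier[of j] e_carrier[of "Suc j"] by (auto simp: w_def)
  obtain x where x: "x \<in> carrier_vec d" "x \<bullet> x = 1" "\<forall>j<d - 1. w j \<bullet> x = 0"
    using underdetermined_homogeneous[of "d - 1" d w, OF _ wc] id by auto
  have pre: "orth_prefix i x"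
    using x id by (auto simp: w_def split: if_splits)
  have hi: "e l \<bullet> x = 0" if "i < l" "l < d" for l
    using x(3)[rule_format, of "l - 1"] that by (cases l) (auto simp: w_def)
  have "lam i = lam i * (\<Sum>l<d. (e l \<bullet> x) * (e l \<bullet> x))"
    using x parseval[OF e_on x(1) x(1)] by simp
  also have "\<dots> = (\<Sum>l<d. lam i * ((e l \<bullet> x) * (e l \<bullet> x)))" by (simp add: sum_distrib_left)
  also have "\<dots> \<le> (\<Sum>l<d. lam l * ((e l \<bullet> x) * (e l \<bullet> x)))"
  proof (intro sum_mono)
    fix l assume l: "l \<in> {..<d}"
    show "lam i * ((e l \<bullet> x) * (e l \<bullet> x)) \<le> lam l * ((e l \<bullet> x) * (e l \<bullet> x))"
      using hi[of l] l lam_antimono[of l i] id by (cases "i < l") (auto intro!: mult_right_mono)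
  qed
  also have "\<dots> = x \<bullet> (M *\<^sub>v x)" using M_quadratic[OF x(1) x(1)] by (simp add: mult.assoc)
  also have "\<dots> \<le> nu i 0" using rayleigh_le_nu0[OF i pre] x by simp
  finally show ?thesis .
qed

lemma nu0_le:
  assumes j: "p \<le> j" "j < k" and B: "0 \<le> B"
    and le: "\<And>x. orth_prefix p x \<Longrightarrow> x \<bullet> (M *\<^sub>v x) \<le> B * (x \<bullet> x)"
  shows "nu j 0 \<le> B"
proof -
  have d0: "0 < d" using j k_le by simp
  define x where "x = P j *\<^sub>v f j 0"
  have f0: "f j 0 \<in> carrier_vec d" "f j 0 \<bullet> f j 0 = 1"
    using f_on[OF j(2)] d0 by (auto simp: orthonormal_fam_def)
  have "orth_prefix p x" using P_orth_prefix[of j "f j 0"] j f0 by (auto simp: x_def)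
  then have "nu j 0 \<le> B * (x \<bullet> x)" using le nu_eq_rayleigh[OF j(2) d0] by (simp add: x_def)
  also have "x \<bullet> x \<le> 1" using P_norm[of j "f j 0"] f0 j by (simp add: x_def sum_nonneg)
  then have "B * (x \<bullet> x) \<le> B" using B by (simp add: mult_left_le)
  finally show ?thesis .
qed

text \<open>As \<open>u j \<bullet> a = 0\<close>, the operator may be replaced by the \<open>j\<close>-th compression minus \<open>nu j 0\<close>. On the top
  eigenvalues the difference is at most \<open>\<gamma> nu j 0\<close>; on the others it is at most \<open>nu j 0\<close>, but
  there \<open>u j\<close> has mass at most \<open>\<delta>\<close>.\<close>

lemma cross_term_le:
  assumes j: "j < k" and a: "orth_prefix (Suc j) a"
  shows "\<bar>u j \<bullet> (M *\<^sub>v a)\<bar> \<le> (\<gamma> + sqrt \<delta>) * nu j 0 * sqrt (a \<bullet> a)"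
proof -
  define S where "S = {l. l < d \<and> nu j l < (1 - \<gamma>) * nu j 0}"
  define F where "F = (\<lambda>l. f j l \<bullet> u j)"
  define A where "A = (\<lambda>l. f j l \<bullet> a)"
  have u: "u j \<in> carrier_vec d" "u j \<bullet> u j = 1" using onu j by (auto simp: orthonormal_fam_def)
  have ac: "a \<in> carrier_vec d" using a by simp
  have nu0: "0 \<le> nu j 0" using nu_nonneg[OF j, of 0] j k_le by simp
  have S: "S \<subseteq> {..<d}" by (auto simp: S_def)
  have "u j \<bullet> (M *\<^sub>v a) = u j \<bullet> ((P j * M * P j) *\<^sub>v a)"
    using compress_eq_on_prefix[OF j u_orth_prefix[OF j], of a] a by simp
  also have "\<dots> = (\<Sum>l<d. nu j l * F l * A l)" unfolding F_def A_def
    by (rule eigenbasis_quadratic[OF compress_carrier[OF j] compress_symmetric[OF j] fb[OF j] u(1) ac])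
  also have "\<dots> = (\<Sum>l<d. (nu j l - nu j 0) * F l * A l) + nu j 0 * (\<Sum>l<d. F l * A l)"
    by (simp add: algebra_simps sum_distrib_left sum_subtractf)
  also have "(\<Sum>l<d. F l * A l) = 0"
    using parseval[OF f_on[OF j] u(1) ac] a by (simp add: F_def A_def)
  also have "(\<Sum>l<d. (nu j l - nu j 0) * F l * A l) =
      (\<Sum>l\<in>{..<d} - S. (nu j l - nu j 0) * F l * A l) + (\<Sum>l\<in>S. (nu j l - nu j 0) * F l * A l)"
    using S by (intro sum.subset_diff) auto
  finally have eq: "u j \<bullet> (M *\<^sub>v a) = (\<Sum>l\<in>{..<d} - S. (nu j l - nu j 0) * F l * A l) +
      (\<Sum>l\<in>S. (nu j l - nu j 0) * F l * A l)" by simp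
  have A_le: "L2_set A B \<le> sqrt (a \<bullet> a)" if "B \<subseteq> {..<d}" for B
    unfolding A_def by (rule L2_set_coords_le[OF f_on[OF j] ac that])
  have nule: "nu j l \<le> nu j 0" if "l < d" for l using nu_antimono[OF j, of 0 l] that by simp
  have "\<bar>\<Sum>l\<in>{..<d} - S. (nu j l - nu j 0) * F l * A l\<bar>
      \<le> (\<gamma> * nu j 0) * (L2_set F ({..<d} - S) * L2_set A ({..<d} - S))"
    using nule \<gamma> nu0 by (intro sum_abs_mult_le_L2) (auto simp: S_def algebra_simps abs_le_iff)
  also have "\<dots> \<le> (\<gamma> * nu j 0) * (1 * sqrt (a \<bullet> a))"
    using L2_set_coords_le[OF f_on[OF j] u(1), of "{..<d} - S"] A_le[of "{..<d} - S"] u \<gamma> nu0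
    by (intro mult_left_mono mult_mono) (auto simp: F_def scalar_prod_self_nonneg)
  finally have t1: "\<bar>\<Sum>l\<in>{..<d} - S. (nu j l - nu j 0) * F l * A l\<bar> \<le> \<gamma> * nu j 0 * sqrt (a \<bullet> a)"
    by simp
  have "\<bar>\<Sum>l\<in>S. (nu j l - nu j 0) * F l * A l\<bar> \<le> nu j 0 * (L2_set F S * L2_set A S)"
    using nule nu_nonneg[OF j] nu0 by (intro sum_abs_mult_le_L2) (auto simp: S_def abs_le_iff)
  also have "\<dots> \<le> nu j 0 * (sqrt \<delta> * sqrt (a \<bullet> a))"
    using low_mass[OF j] A_le[OF S] nu0
    by (intro mult_left_mono mult_mono) (auto simp: F_def S_def L2_set_def scalar_prod_self_nonneg \<delta> sum_nonneg)
  finally have t2: "\<bar>\<Sum>l\<in>S. (nu j l - nu j 0) * F l * A l\<bar> \<le> sqrt \<delta> * nu j 0 * sqrt (a \<bullet> a)"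
    by (simp add: algebra_simps)
  show ?thesis using eq t1 t2 by (simp add: algebra_simps)
qed


section \<open>Low part of a new vector\<close>

lemma top_space_orth_prefix:
  assumes i: "i < k" and \<mu>: "0 < \<mu>" and a: "a \<in> carrier_vec d"
    and top: "\<And>l. l < d \<Longrightarrow> nu i l < \<mu> \<Longrightarrow> f i l \<bullet> a = 0"
  shows "orth_prefix i a"
proof (intro conjI allI impI)
  fix j assume j: "j < i"
  then have jk: "j < k" using i by simp
  have "(f i l \<bullet> u j) * (f i l \<bullet> a) = 0" if l: "l < d" for l
  proof (cases "nu i l < \<mu>")
    case True
    then show ?thesis using top l by simp
  next
    case False
    have fl: "f i l \<in> carrier_vec d" using f_carrier i l by simp
    have "nu i l * (u j \<bullet> f i l) = u j \<bullet> ((P i * M * P i) *\<^sub>v f i l)"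
      using fb[OF i] l fl u_carrier[OF jk] by (simp add: eigenbasis_def)
    also have "\<dots> = 0"
      using fl i j M P_vec[of i "f i l"] by (simp add: compress_vec u_P_zero)
    finally have "u j \<bullet> f i l = 0" using False \<mu> by simp
    then show ?thesis using comm_scalar_prod[OF fl u_carrier[OF jk]] by simp
  qed
  then show "u j \<bullet> a = 0"
    unfolding parseval[OF f_on[OF i] u_carrier[OF jk] a] by (intro sum.neutral) auto
qed (rule a)

text \<open>With \<open>L\<close> the norm of the coordinates in \<open>S\<close> and \<open>s\<close> its supremum over the unit ball \<open>T\<close> of the top
  space, inverting the compression on the top space gives \<open>L b \<le> (\<theta> s + i \<epsilon> X) / \<mu>\<close> for all \<open>b\<close> in \<open>T\<close>,
  and hence \<open>s \<le> (\<theta> s + i \<epsilon> X) / \<mu>\<close>. The supremum over the whole space is needed because \<open>b\<close> is not an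
  eigenvector: its preimage \<open>c\<close> is a different vector, about which only membership is known.\<close>

lemma top_space_low_part:
  assumes i: "i < k" and S: "S \<subseteq> {..<d}"
    and \<theta>: "0 \<le> \<theta>" "\<And>l. l \<in> S \<Longrightarrow> lam l \<le> \<theta>" and \<mu>: "\<theta> < \<mu>"
    and \<epsilon>: "0 \<le> \<epsilon>" "\<And>j a. j < i \<Longrightarrow> orth_prefix i a \<Longrightarrow> \<bar>u j \<bullet> (M *\<^sub>v a)\<bar> \<le> \<epsilon> * sqrt (a \<bullet> a)"
    and X: "\<And>j. j < i \<Longrightarrow> L2_set (\<lambda>l. e l \<bullet> u j) S \<le> X" "0 \<le> X"
    and a: "a \<in> carrier_vec d" "a \<bullet> a \<le> 1"
    and top: "\<And>l. l < d \<Longrightarrow> nu i l < \<mu> \<Longrightarrow> f i l \<bullet> a = 0"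
  shows "L2_set (\<lambda>l. e l \<bullet> a) S * (\<mu> - \<theta>) \<le> real i * \<epsilon> * X"
proof -
  have \<mu>0: "0 < \<mu>" using \<theta>(1) \<mu> by simp
  define T where "T = {a \<in> carrier_vec d. a \<bullet> a \<le> 1 \<and> (\<forall>l<d. nu i l < \<mu> \<longrightarrow> f i l \<bullet> a = 0)}"
  define L where "L = (\<lambda>a. L2_set (\<lambda>l. e l \<bullet> a) S)"
  define s where "s = Sup (L ` T)"
  have aT: "a \<in> T" using a top by (simp add: T_def)
  have "L b \<le> 1" if "b \<in> T" for b
    using L2_set_coords_le[OF e_on _ S, of b] that
    by (auto simp: T_def L_def intro: order_trans[OF _ real_sqrt_le_1_iff[THEN iffD2]])
  then have bdd: "bdd_above (L ` T)" by (intro bdd_aboveI2) auto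
  have L_le: "L b \<le> s" if "b \<in> T" for b
    unfolding s_def using that by (intro cSUP_upper bdd)
  have main: "L b \<le> (\<theta> * s + real i * \<epsilon> * X) / \<mu>" if b: "b \<in> T" for b
  proof -
    have bc: "b \<in> carrier_vec d" "b \<bullet> b \<le> 1" "\<And>l. l < d \<Longrightarrow> nu i l < \<mu> \<Longrightarrow> f i l \<bullet> b = 0"
      using b by (auto simp: T_def)
    \<comment> \<open>The preimage of \<open>b\<close> under the compression within the top space.\<close>
    obtain c where c: "c \<in> carrier_vec d"
        "\<forall>l<d. f i l \<bullet> c = (if nu i l < \<mu> then 0 else (f i l \<bullet> b) / nu i l)"
      using vec_with_coords[OF f_on[OF i], of "\<lambda>l. if nu i l < \<mu> then 0 else (f i l \<bullet> b) / nu i l"]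
      by blast
    have c_top: "f i l \<bullet> c = 0" if "l < d" "nu i l < \<mu>" for l using c(2) that by simp
    have pre: "orth_prefix i c" by (rule top_space_orth_prefix[OF i \<mu>0 c(1) c_top])
    have Cc: "(P i * M * P i) *\<^sub>v c = b"
    proof (rule vec_eq_coords[OF f_on[OF i]])
      show "(P i * M * P i) *\<^sub>v c \<in> carrier_vec d"
        by (rule mult_mat_vec_carrier[OF compress_carrier[OF i] c(1)])
      fix l assume l: "l < d"
      have "f i l \<bullet> ((P i * M * P i) *\<^sub>v c) = nu i l * (f i l \<bullet> c)"
        by (rule bilinear_eigenbasis[OF compress_carrier[OF i] compress_symmetric[OF i] fb[OF i] c(1) l])
      also have "\<dots> = f i l \<bullet> b" using c(2) l bc(3)[OF l] \<mu>0 by auto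
      finally show "f i l \<bullet> ((P i * M * P i) *\<^sub>v c) = f i l \<bullet> b" .
    qed (rule bc(1))
    have "\<bar>f i l \<bullet> c\<bar> \<le> \<bar>f i l \<bullet> b\<bar> / \<mu>" if l: "l < d" for l
    proof (cases "nu i l < \<mu>")
      case True
      then have "f i l \<bullet> c = 0" using c_top l by simp
      then show ?thesis using \<mu>0 by simp
    next
      case False
      then have "\<bar>f i l \<bullet> c\<bar> = \<bar>f i l \<bullet> b\<bar> / nu i l" using c(2) l \<mu>0 by simp
      also have "\<dots> \<le> \<bar>f i l \<bullet> b\<bar> / \<mu>" using False \<mu>0 by (intro frac_le) auto
      finally show ?thesis .
    qed
    then have "(f i l \<bullet> c) * (f i l \<bullet> c) \<le> (f i l \<bullet> b) * (f i l \<bullet> b) / \<mu>\<^sup>2" if l: "l < d" for l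
      using power_mono[of "\<bar>f i l \<bullet> c\<bar>" "\<bar>f i l \<bullet> b\<bar> / \<mu>" 2] l
      by (simp add: power_divide power2_eq_square)
    then have "c \<bullet> c \<le> (\<Sum>l<d. (f i l \<bullet> b) * (f i l \<bullet> b) / \<mu>\<^sup>2)"
      unfolding parseval[OF f_on[OF i] c(1) c(1)] by (intro sum_mono) auto
    also have "\<dots> = (b \<bullet> b) / \<mu>\<^sup>2"
      unfolding parseval[OF f_on[OF i] bc(1) bc(1)] by (simp add: sum_divide_distrib)
    also have "\<dots> \<le> 1 / \<mu>\<^sup>2" using bc(2) by (simp add: divide_right_mono)
    finally have cc: "c \<bullet> c \<le> 1 / \<mu>\<^sup>2" .
    then have "sqrt (c \<bullet> c) \<le> sqrt (1 / \<mu>\<^sup>2)" by (rule real_sqrt_le_mono)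
    then have c_norm: "sqrt (c \<bullet> c) \<le> 1 / \<mu>" using \<mu>0 by (simp add: real_sqrt_divide)
    have "\<mu> \<cdot>\<^sub>v c \<in> T"
      using c(1) c_top cc \<mu>0 f_carrier[OF i] by (auto simp: T_def field_simps power2_eq_square)
    then have "L (\<mu> \<cdot>\<^sub>v c) \<le> s" by (rule L_le)
    moreover have "L (\<mu> \<cdot>\<^sub>v c) = \<mu> * L c"
      unfolding L_def using c(1) e_carrier S \<mu>0
      by (subst L2_set_right_distrib) (auto intro!: L2_set_cong)
    ultimately have Lc: "L c \<le> s / \<mu>" using \<mu>0 by (simp add: field_simps)
    have Mc: "M *\<^sub>v c \<in> carrier_vec d" using M c by simp
    \<comment> \<open>\<open>b = P i (M c)\<close>, read on the eigenvectors of \<open>M\<close>.\<close>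
    have eb_eq: "e l \<bullet> b = lam l * (e l \<bullet> c) + (\<Sum>j<i. - ((u j \<bullet> (M *\<^sub>v c)) * (e l \<bullet> u j)))"
      if l: "l < d" for l
    proof -
      have "e l \<bullet> b = e l \<bullet> (P i *\<^sub>v (M *\<^sub>v c))"
        using Cc compress_vec[OF i c(1)] P_fix[of i c] pre i by simp
      also have "\<dots> = e l \<bullet> (M *\<^sub>v c) - (\<Sum>j<i. (u j \<bullet> e l) * (u j \<bullet> (M *\<^sub>v c)))"
        using i by (intro P_form Mc e_carrier l) simp
      also have "e l \<bullet> (M *\<^sub>v c) = lam l * (e l \<bullet> c)" by (rule bilinear_eigenbasis[OF M eb c(1) l])
      also have "(\<Sum>j<i. (u j \<bullet> e l) * (u j \<bullet> (M *\<^sub>v c))) = (\<Sum>j<i. (u j \<bullet> (M *\<^sub>v c)) * (e l \<bullet> u j))"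
        using i by (intro sum.cong refl) (simp add: comm_scalar_prod[OF u_carrier e_carrier[OF l]])
      finally show ?thesis by (simp add: sum_negf)
    qed
    have "L b = L2_set (\<lambda>l. lam l * (e l \<bullet> c) + (\<Sum>j<i. - ((u j \<bullet> (M *\<^sub>v c)) * (e l \<bullet> u j)))) S"
      unfolding L_def using S eb_eq by (intro L2_set_cong) auto
    also have "\<dots> \<le> L2_set (\<lambda>l. lam l * (e l \<bullet> c)) S +
        L2_set (\<lambda>l. \<Sum>j<i. - ((u j \<bullet> (M *\<^sub>v c)) * (e l \<bullet> u j))) S"
      by (rule L2_set_triangle_ineq)
    also have "L2_set (\<lambda>l. lam l * (e l \<bullet> c)) S \<le> L2_set (\<lambda>l. \<theta> * \<bar>e l \<bullet> c\<bar>) S"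
    proof -
      have "L2_set (\<lambda>l. lam l * (e l \<bullet> c)) S = L2_set (\<lambda>l. \<bar>lam l * (e l \<bullet> c)\<bar>) S"
        by (simp add: L2_set_def)
      also have "\<dots> \<le> L2_set (\<lambda>l. \<theta> * \<bar>e l \<bullet> c\<bar>) S"
        using S \<theta> lam_nonneg by (intro L2_set_mono) (auto simp: abs_mult intro!: mult_right_mono)
      finally show ?thesis .
    qed
    also have "L2_set (\<lambda>l. \<theta> * \<bar>e l \<bullet> c\<bar>) S = \<theta> * L c"
      using L2_set_right_distrib[OF \<theta>(1), of "\<lambda>l. \<bar>e l \<bullet> c\<bar>" S] by (simp add: L_def L2_set_def)
    also have "L2_set (\<lambda>l. \<Sum>j<i. - ((u j \<bullet> (M *\<^sub>v c)) * (e l \<bullet> u j))) S \<le>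
        (\<Sum>j<i. L2_set (\<lambda>l. - ((u j \<bullet> (M *\<^sub>v c)) * (e l \<bullet> u j))) S)" by (rule L2_set_sum_le)
    also have "\<dots> \<le> (\<Sum>j<i. (\<epsilon> * (1 / \<mu>)) * X)"
    proof (intro sum_mono)
      fix j assume j: "j \<in> {..<i}"
      have "L2_set (\<lambda>l. - ((u j \<bullet> (M *\<^sub>v c)) * (e l \<bullet> u j))) S =
          \<bar>u j \<bullet> (M *\<^sub>v c)\<bar> * L2_set (\<lambda>l. e l \<bullet> u j) S"
        by (subst L2_set_right_distrib) (auto simp: L2_set_def power_mult_distrib)
      also have "\<dots> \<le> (\<epsilon> * sqrt (c \<bullet> c)) * X"
        using \<epsilon> X j pre by (intro mult_mono) (auto simp: scalar_prod_self_nonneg)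
      also have "\<dots> \<le> (\<epsilon> * (1 / \<mu>)) * X"
        using c_norm \<epsilon>(1) X(2) by (intro mult_right_mono mult_left_mono) auto
      finally show "L2_set (\<lambda>l. - ((u j \<bullet> (M *\<^sub>v c)) * (e l \<bullet> u j))) S \<le> (\<epsilon> * (1 / \<mu>)) * X" .
    qed
    also have "\<theta> * L c \<le> \<theta> * (s / \<mu>)" using Lc \<theta>(1) by (rule mult_left_mono)
    finally show ?thesis by (simp add: add_divide_distrib)
  qed
  have "s \<le> (\<theta> * s + real i * \<epsilon> * X) / \<mu>"
    unfolding s_def using aT main[unfolded s_def] by (intro cSUP_least) auto
  then have "s * (\<mu> - \<theta>) \<le> real i * \<epsilon> * X" using \<mu>0 by (simp add: field_simps)
  moreover have "L a * (\<mu> - \<theta>) \<le> s * (\<mu> - \<theta>)" using L_le[OF aT] \<mu> by (intro mult_right_mono) auto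
  ultimately show ?thesis by (simp add: L_def)
qed

text \<open>Splits \<open>u i\<close> into its part \<open>a\<close> in the top space of the \<open>i\<close>-th compression, to which
  \<open>top_space_low_part\<close> applies, and a remainder of norm at most \<open>sqrt \<delta>\<close>.\<close>

lemma step_low_part:
  assumes i: "i < k" and S: "S \<subseteq> {..<d}"
    and \<theta>: "0 \<le> \<theta>" "\<And>l. l \<in> S \<Longrightarrow> lam l \<le> \<theta>" and \<mu>: "\<theta> < (1 - \<gamma>) * nu i 0"
    and \<epsilon>: "0 \<le> \<epsilon>" "\<And>j a. j < i \<Longrightarrow> orth_prefix i a \<Longrightarrow> \<bar>u j \<bullet> (M *\<^sub>v a)\<bar> \<le> \<epsilon> * sqrt (a \<bullet> a)"
    and X: "\<And>j. j < i \<Longrightarrow> L2_set (\<lambda>l. e l \<bullet> u j) S \<le> X" "0 \<le> X"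
  shows "L2_set (\<lambda>l. e l \<bullet> u i) S \<le> real i * \<epsilon> * X / ((1 - \<gamma>) * nu i 0 - \<theta>) + sqrt \<delta>"
proof -
  define \<mu> where "\<mu> = (1 - \<gamma>) * nu i 0"
  have ui: "u i \<in> carrier_vec d" "u i \<bullet> u i = 1" using onu i by (auto simp: orthonormal_fam_def)
  obtain a where a: "a \<in> carrier_vec d" "\<forall>l<d. f i l \<bullet> a = (if nu i l < \<mu> then 0 else f i l \<bullet> u i)"
    using vec_with_coords[OF f_on[OF i], of "\<lambda>l. if nu i l < \<mu> then 0 else f i l \<bullet> u i"] by blast
  define b where "b = u i - a"
  have b: "b \<in> carrier_vec d" using a ui by (simp add: b_def)
  have fb: "f i l \<bullet> b = (if nu i l < \<mu> then f i l \<bullet> u i else 0)" if l: "l < d" for l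
    using a l ui f_carrier[OF i l] by (simp add: b_def scalar_prod_minus_distrib[of _ d])
  have "a \<bullet> a = (\<Sum>l<d. (f i l \<bullet> a) * (f i l \<bullet> a))" by (rule parseval[OF f_on[OF i] a(1) a(1)])
  also have "\<dots> \<le> (\<Sum>l<d. (f i l \<bullet> u i) * (f i l \<bullet> u i))" using a(2) by (intro sum_mono) auto
  also have "\<dots> = 1" using parseval[OF f_on[OF i] ui(1) ui(1)] ui by simp
  finally have a1: "a \<bullet> a \<le> 1" .
  have "b \<bullet> b = (\<Sum>l<d. (f i l \<bullet> b) * (f i l \<bullet> b))" by (rule parseval[OF f_on[OF i] b b])
  also have "\<dots> = (\<Sum>l<d. if nu i l < \<mu> then (f i l \<bullet> u i)\<^sup>2 else 0)"
    using fb by (intro sum.cong) (auto simp: power2_eq_square)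
  also have "\<dots> = (\<Sum>l | l < d \<and> nu i l < \<mu>. (f i l \<bullet> u i)\<^sup>2)"
    by (subst sum.If_cases) (auto intro!: sum.cong)
  also have "\<dots> \<le> \<delta>" using low_mass[OF i] by (simp add: \<mu>_def)
  finally have b1: "sqrt (b \<bullet> b) \<le> sqrt \<delta>" by simp
  have "L2_set (\<lambda>l. e l \<bullet> u i) S = L2_set (\<lambda>l. e l \<bullet> a + e l \<bullet> b) S"
  proof (rule L2_set_cong)
    fix l assume "l \<in> S"
    then have "e l \<in> carrier_vec d" using S e_carrier by auto
    then show "e l \<bullet> u i = e l \<bullet> a + e l \<bullet> b"
      using a ui by (simp add: b_def scalar_prod_minus_distrib[of _ d])
  qed simp
  also have "\<dots> \<le> L2_set (\<lambda>l. e l \<bullet> a) S + L2_set (\<lambda>l. e l \<bullet> b) S" by (rule L2_set_triangle_ineq)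
  also have "L2_set (\<lambda>l. e l \<bullet> b) S \<le> sqrt \<delta>"
    by (rule order_trans[OF L2_set_coords_le[OF e_on b S] b1])
  also have "L2_set (\<lambda>l. e l \<bullet> a) S * (\<mu> - \<theta>) \<le> real i * \<epsilon> * X"
    by (rule top_space_low_part[OF i S \<theta> _ \<epsilon> X a(1) a1]) (use \<mu> a(2) in \<open>auto simp: \<mu>_def\<close>)
  then have "L2_set (\<lambda>l. e l \<bullet> a) S \<le> real i * \<epsilon> * X / (\<mu> - \<theta>)"
    using \<mu> by (simp add: pos_le_divide_eq \<mu>_def)
  finally show ?thesis by (simp add: \<mu>_def)
qed

section \<open>Vectors orthogonal to a captured top eigenspace\<close>

text \<open>For \<open>l < p\<close>, \<open>e l \<bullet> a\<close> is the inner product of \<open>a\<close> with the part of \<open>e l\<close> not captured by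
  \<open>u 0, \<dots>, u (p - 1)\<close>. The captured squared masses of \<open>e 0, \<dots>, e (p - 1)\<close> sum to at least \<open>p - D\<close>,
  because the \<open>p\<close> unit vectors \<open>u j\<close> have only mass \<open>D\<close> elsewhere; so at most \<open>D\<close> is left for
  \<open>a\<close>. That both families have the same size \<open>p\<close> is essential.\<close>

lemma captured_top_mass:
  assumes p: "p \<le> k" and D: "(\<Sum>j<p. \<Sum>l\<in>{p..<d}. (e l \<bullet> u j)\<^sup>2) \<le> D" and a: "orth_prefix p a"
  shows "(\<Sum>l<p. (e l \<bullet> a)\<^sup>2) \<le> D * (a \<bullet> a)"
proof -
  have pd: "p \<le> d" using p k_le by simp
  have ac: "a \<in> carrier_vec d" using a by simp
  have "(e l \<bullet> a)\<^sup>2 \<le> (1 - (\<Sum>j<p. (e l \<bullet> u j)\<^sup>2)) * (a \<bullet> a)" if l: "l < p" for l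
  proof -
    have el: "e l \<in> carrier_vec d" "e l \<bullet> e l = 1" using e_on l pd by (auto simp: orthonormal_fam_def)
    have "e l \<bullet> a = (P p *\<^sub>v e l) \<bullet> a"
      using P_self[OF p el(1) ac] P_fix[OF p a] by simp
    also have "\<dots> = (\<Sum>m<d. (e m \<bullet> (P p *\<^sub>v e l)) * (e m \<bullet> a))"
      by (rule parseval[OF e_on P_vec[OF p el(1)] ac])
    finally have "\<bar>e l \<bullet> a\<bar> \<le> 1 * (L2_set (\<lambda>m. e m \<bullet> (P p *\<^sub>v e l)) {..<d} * L2_set (\<lambda>m. e m \<bullet> a) {..<d})"
      using sum_abs_mult_le_L2[of "{..<d}" "\<lambda>_. 1" 1] by simp
    also have "\<dots> = sqrt ((P p *\<^sub>v e l) \<bullet> (P p *\<^sub>v e l)) * sqrt (a \<bullet> a)"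
      using parseval_L2[OF e_on ac] parseval_L2[OF e_on P_vec[OF p el(1)]] by simp
    finally have "\<bar>e l \<bullet> a\<bar>\<^sup>2 \<le> (sqrt ((P p *\<^sub>v e l) \<bullet> (P p *\<^sub>v e l)) * sqrt (a \<bullet> a))\<^sup>2"
      by (intro power_mono) auto
    also have "\<dots> = ((P p *\<^sub>v e l) \<bullet> (P p *\<^sub>v e l)) * (a \<bullet> a)"
      by (simp add: power_mult_distrib scalar_prod_self_nonneg)
    also have "(P p *\<^sub>v e l) \<bullet> (P p *\<^sub>v e l) = 1 - (\<Sum>j<p. (u j \<bullet> e l)\<^sup>2)"
      using P_norm[OF p el(1)] el(2) by simp
    also have "(\<Sum>j<p. (u j \<bullet> e l)\<^sup>2) = (\<Sum>j<p. (e l \<bullet> u j)\<^sup>2)"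
      using p by (intro sum.cong refl) (simp add: comm_scalar_prod[OF u_carrier el(1)])
    finally show ?thesis by simp
  qed
  then have "(\<Sum>l<p. (e l \<bullet> a)\<^sup>2) \<le> (\<Sum>l<p. (1 - (\<Sum>j<p. (e l \<bullet> u j)\<^sup>2)) * (a \<bullet> a))"
    by (intro sum_mono) auto
  also have "\<dots> = (real p - (\<Sum>j<p. \<Sum>l<p. (e l \<bullet> u j)\<^sup>2)) * (a \<bullet> a)"
    using sum.swap[of "\<lambda>l j. (e l \<bullet> u j)\<^sup>2" "{..<p}" "{..<p}"]
    by (simp add: sum_subtractf flip: sum_distrib_right)
  also have "(\<Sum>j<p. \<Sum>l<p. (e l \<bullet> u j)\<^sup>2) = (\<Sum>j<p. 1 - (\<Sum>l\<in>{p..<d}. (e l \<bullet> u j)\<^sup>2))"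
  proof (intro sum.cong refl)
    fix j assume "j \<in> {..<p}"
    then have uj: "u j \<in> carrier_vec d" "u j \<bullet> u j = 1" using onu p by (auto simp: orthonormal_fam_def)
    have "1 = (\<Sum>l<d. (e l \<bullet> u j)\<^sup>2)"
      using parseval[OF e_on uj(1) uj(1)] uj(2) by (simp add: power2_eq_square)
    also have "\<dots> = (\<Sum>l<p. (e l \<bullet> u j)\<^sup>2) + (\<Sum>l\<in>{p..<d}. (e l \<bullet> u j)\<^sup>2)"
      using pd sum.atLeastLessThan_concat[of 0 p d "\<lambda>l. (e l \<bullet> u j)\<^sup>2"] by (simp add: atLeast0LessThan)
    finally show "(\<Sum>l<p. (e l \<bullet> u j)\<^sup>2) = 1 - (\<Sum>l\<in>{p..<d}. (e l \<bullet> u j)\<^sup>2)" by simp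
  qed
  also have "(real p - \<dots>) * (a \<bullet> a) \<le> D * (a \<bullet> a)"
    using D by (intro mult_right_mono scalar_prod_self_nonneg) (simp add: sum_subtractf)
  finally show ?thesis .
qed

lemma sum_split_at: "p \<le> d \<Longrightarrow> (\<Sum>l<d. g l) = (\<Sum>l<p. g l) + (\<Sum>l\<in>{p..<d}. g l :: real)"
  using sum.atLeastLessThan_concat[of 0 p d g] by (simp add: atLeast0LessThan)

text \<open>After a captured gap the compressions live at the scale of \<open>lam p\<close>, up to leakage from the
  large eigenvalues.\<close>

lemma rayleigh_after_capture:
  assumes p: "p < k" and D: "(\<Sum>j<p. \<Sum>l\<in>{p..<d}. (e l \<bullet> u j)\<^sup>2) \<le> D" and a: "orth_prefix p a"
  shows "a \<bullet> (M *\<^sub>v a) \<le> (lam p + D * lam 0) * (a \<bullet> a)"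
proof -
  have pd: "p < d" using p k_le by simp
  have ac: "a \<in> carrier_vec d" using a by simp
  have "a \<bullet> (M *\<^sub>v a) = (\<Sum>l<p. lam l * (e l \<bullet> a)\<^sup>2) + (\<Sum>l\<in>{p..<d}. lam l * (e l \<bullet> a)\<^sup>2)"
    using M_quadratic[OF ac ac] sum_split_at[of p] pd by (simp add: power2_eq_square mult.assoc)
  also have "(\<Sum>l<p. lam l * (e l \<bullet> a)\<^sup>2) \<le> (\<Sum>l<p. lam 0 * (e l \<bullet> a)\<^sup>2)"
    using lam_antimono[of 0] pd by (intro sum_mono mult_right_mono) auto
  also have "\<dots> = lam 0 * (\<Sum>l<p. (e l \<bullet> a)\<^sup>2)" by (simp add: sum_distrib_left)
  also have "\<dots> \<le> lam 0 * (D * (a \<bullet> a))"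
    using captured_top_mass[OF _ D a] p lam_nonneg[of 0] pd by (intro mult_left_mono) auto
  also have "(\<Sum>l\<in>{p..<d}. lam l * (e l \<bullet> a)\<^sup>2) \<le> (\<Sum>l\<in>{p..<d}. lam p * (e l \<bullet> a)\<^sup>2)"
    using lam_antimono[of p] by (intro sum_mono mult_right_mono) auto
  also have "\<dots> = lam p * (\<Sum>l\<in>{p..<d}. (e l \<bullet> a)\<^sup>2)" by (simp add: sum_distrib_left)
  also have "\<dots> \<le> lam p * (a \<bullet> a)"
  proof (intro mult_left_mono)
    show "(\<Sum>l\<in>{p..<d}. (e l \<bullet> a)\<^sup>2) \<le> a \<bullet> a"
      using parseval[OF e_on ac ac] sum_split_at[of p "\<lambda>l. (e l \<bullet> a)\<^sup>2"] pd
      by (simp add: power2_eq_square sum_nonneg)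
  qed (use lam_nonneg pd in auto)
  finally show ?thesis by (simp add: algebra_simps)
qed

text \<open>On \<open>e 0, \<dots>, e (p - 1)\<close> the factor of \<open>a\<close> is small and on the remaining eigenvectors that of \<open>u j\<close>,
  each by \<open>sqrt D\<close>. Compared with \<open>cross_term_le\<close> the error \<open>\<gamma>\<close> is absent, which matters because
  the large eigenvalue \<open>lam 0\<close> would multiply it.\<close>

lemma cross_term_after_capture:
  assumes p: "p < k" and D: "(\<Sum>j<p. \<Sum>l\<in>{p..<d}. (e l \<bullet> u j)\<^sup>2) \<le> D" and j: "j < p"
    and a: "orth_prefix p a"
  shows "\<bar>u j \<bullet> (M *\<^sub>v a)\<bar> \<le> 2 * sqrt D * lam 0 * sqrt (a \<bullet> a)"
proof -
  have pd: "p < d" using p k_le by simp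
  have ac: "a \<in> carrier_vec d" using a by simp
  have uj: "u j \<in> carrier_vec d" "u j \<bullet> u j = 1" using onu p j by (auto simp: orthonormal_fam_def)
  have l0: "0 \<le> lam 0" using lam_nonneg pd by simp
  have lam: "\<bar>lam l\<bar> \<le> lam 0" if "l < d" for l using lam_nonneg that lam_antimono[of 0 l] by auto
  have D0: "0 \<le> D" by (rule order_trans[OF _ D]) (auto intro!: sum_nonneg)
  have sub: "{..<p} \<subseteq> {..<d}" "{p..<d} \<subseteq> {..<d}" using pd by auto
  have "(\<Sum>l\<in>{p..<d}. (e l \<bullet> u j)\<^sup>2) \<le> (\<Sum>j<p. \<Sum>l\<in>{p..<d}. (e l \<bullet> u j)\<^sup>2)"
    using j by (intro member_le_sum) (auto intro!: sum_nonneg)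
  then have low: "L2_set (\<lambda>l. e l \<bullet> u j) {p..<d} \<le> sqrt D" using D by (simp add: L2_set_def)
  have "L2_set (\<lambda>l. e l \<bullet> a) {..<p} \<le> sqrt (D * (a \<bullet> a))"
    using captured_top_mass[OF _ D a] p by (simp add: L2_set_def)
  then have top: "L2_set (\<lambda>l. e l \<bullet> a) {..<p} \<le> sqrt D * sqrt (a \<bullet> a)" by (simp add: real_sqrt_mult)
  have "u j \<bullet> (M *\<^sub>v a) = (\<Sum>l<p. lam l * (e l \<bullet> u j) * (e l \<bullet> a)) +
      (\<Sum>l\<in>{p..<d}. lam l * (e l \<bullet> u j) * (e l \<bullet> a))"
    using M_quadratic[OF uj(1) ac] sum_split_at[of p] pd by simp
  moreover have "\<bar>\<Sum>l<p. lam l * (e l \<bullet> u j) * (e l \<bullet> a)\<bar> \<le> lam 0 * (1 * (sqrt D * sqrt (a \<bullet> a)))"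
    using L2_set_coords_le[OF e_on uj(1) sub(1)] uj(2) top l0 lam pd D0
    by (intro order_trans[OF sum_abs_mult_le_L2[where b = "lam 0"]] mult_left_mono mult_mono) (auto simp: scalar_prod_self_nonneg)
  moreover have "\<bar>\<Sum>l\<in>{p..<d}. lam l * (e l \<bullet> u j) * (e l \<bullet> a)\<bar> \<le> lam 0 * (sqrt D * sqrt (a \<bullet> a))"
    using L2_set_coords_le[OF e_on ac sub(2)] low l0 lam pd D0
    by (intro order_trans[OF sum_abs_mult_le_L2[where b = "lam 0"]] mult_left_mono mult_mono) auto
  ultimately show ?thesis by (simp add: algebra_simps)
qed

end

section \<open>Induction over the number of steps\<close>

lemma antimono_chain_lower:
  fixes lam :: "nat \<Rightarrow> real"
  assumes nogap: "\<And>t. p < t \<Longrightarrow> t \<le> r \<Longrightarrow> (1 - G) * lam (t - 1) \<le> lam t"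
    and G: "0 \<le> G" "G \<le> 1" and pr: "p \<le> r" and lp: "0 \<le> lam p"
  shows "(1 - real (r - p) * G) * lam p \<le> lam r"
  using pr nogap
proof (induction r rule: dec_induct)
  case (step n)
  have "(1 - real (Suc n - p) * G) * lam p \<le> (1 - G) * ((1 - real (n - p) * G) * lam p)"
  proof -
    have "1 - real (Suc n - p) * G \<le> (1 - G) * (1 - real (n - p) * G)"
      using step(1) G by (simp add: Suc_diff_le algebra_simps mult_left_mono)
    then show ?thesis unfolding mult.assoc[symmetric] using lp by (rule mult_right_mono)
  qed
  also have "\<dots> \<le> (1 - G) * lam n" using step G by (intro mult_left_mono) auto
  also have "\<dots> \<le> lam (Suc n)" using step.prems[of "Suc n"] step(1) by simp
  finally show ?case .
qed simp

context deflation
begin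

definition low_set :: "real \<Rightarrow> nat \<Rightarrow> nat set" where
  "low_set G q = {l. l < d \<and> lam l < (1 - G) * lam (q - 1)}"

lemma low_set_subset:
  assumes "0 \<le> G" "q \<le> d"
  shows "low_set G q \<subseteq> {q..<d}"
proof
  fix l assume l: "l \<in> low_set G q"
  have "q \<le> l"
  proof (rule ccontr)
    assume "\<not> q \<le> l"
    then have "lam (q - 1) \<le> lam l" "0 \<le> lam (q - 1)" using lam_antimono[of l "q - 1"] lam_nonneg[of "q - 1"] assms by auto
    moreover have "(1 - G) * lam (q - 1) \<le> 1 * lam (q - 1)"
      using assms calculation(2) by (intro mult_right_mono) auto
    ultimately show False using l by (simp add: low_set_def)
  qed
  then show "l \<in> {q..<d}" using l by (simp add: low_set_def)
qed

text \<open>At a gap the mass on low eigenvectors, which the induction controls, is the mass from index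
  \<open>p\<close> on, which \<open>captured_top_mass\<close> requires.\<close>

lemma low_set_at_gap:
  assumes "0 \<le> G" "p \<le> d" "lam p < (1 - G) * lam (p - 1)"
  shows "low_set G p = {p..<d}"
  using low_set_subset[OF assms(1,2)] lam_antimono[of p] assms(3)
  by (fastforce simp: low_set_def)

text \<open>The hypothesis \<open>small\<close> collects what makes every cross term at most
  \<open>G lam (q - 1) / (4 k\<^sup>2)\<close>: the first summand serves the vectors before the last gap, the other
  two those after it. The separation \<open>\<mu> - \<theta>\<close> is at least \<open>G lam (q - 1) / 2\<close>, so \<open>k\<close> cross
  terms add to \<open>u i\<close> at most \<open>1 / (2 k)\<close> of the root of the mass accumulated so far.\<close>

lemma low_mass_bound:
  assumes G: "0 < G" "real k * G \<le> 1/2" and pos: "0 < lam (k - 1)"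
    and D: "\<And>q. q \<le> k \<Longrightarrow> (1 + 1 / real k) ^ q * (2 * real q * \<delta>) \<le> D"
    and small: "2 * sqrt D * (lam 0 / lam (k - 1)) + 3 * \<gamma> + 3 * sqrt \<delta> \<le> G / (4 * (real k)\<^sup>2)"
    and q: "1 \<le> q" "q \<le> k"
  shows "(\<Sum>j<q. \<Sum>l\<in>low_set G q. (e l \<bullet> u j)\<^sup>2) \<le> (1 + 1 / real k) ^ q * (2 * real q * \<delta>)"
  using q
proof (induction q rule: less_induct)
  case (less q)
  define B where "B = (\<lambda>q. (1 + 1 / real k) ^ q * (2 * real q * \<delta>))"
  have k: "1 \<le> real k" using less.prems by simp
  have qd: "q \<le> d" "q - 1 < d" using less.prems k_le by auto
  have "1 * G \<le> real k * G" using k G(1) by (intro mult_right_mono) auto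
  then have G1: "G \<le> 1/2" using G(2) by linarith
  define gap where "gap = (\<lambda>t. lam t < (1 - G) * lam (t - 1))"
  \<comment> \<open>The last gap before \<open>q\<close>, or \<open>0\<close> if there is none.\<close>
  define p where "p = Max {p. p < q \<and> (p = 0 \<or> gap p)}"
  have fin: "finite {p. p < q \<and> (p = 0 \<or> gap p)}" by simp
  have "0 \<in> {p. p < q \<and> (p = 0 \<or> gap p)}" using less.prems by simp
  then have p: "p < q" "p = 0 \<or> gap p" using Max_in[OF fin] unfolding p_def by blast+
  have nogap: "\<not> gap t" if "p < t" "t < q" for t
  proof
    assume "gap t"
    then have "t \<le> p" unfolding p_def using that by (intro Max_ge[OF fin]) simp
    then show False using that by simp
  qed
  have pk: "p < k" "p < d" using p less.prems k_le by auto
  have D0: "0 \<le> D" using D[of 0] by simp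
  have mass_p: "(\<Sum>j<p. \<Sum>l\<in>{p..<d}. (e l \<bullet> u j)\<^sup>2) \<le> B p"
  proof (cases "p = 0")
    case True
    then show ?thesis by (simp add: B_def)
  next
    case False
    then have "low_set G p = {p..<d}"
      using p(2) pk G by (intro low_set_at_gap) (auto simp: gap_def)
    then show ?thesis using less.IH[OF p(1)] False pk by (simp add: B_def)
  qed
  have mass_p_D: "(\<Sum>j<p. \<Sum>l\<in>{p..<d}. (e l \<bullet> u j)\<^sup>2) \<le> D"
    using mass_p D[of p] pk by (simp add: B_def)
  define \<Lambda> where "\<Lambda> = lam (q - 1)"
  have \<Lambda>k: "lam (k - 1) \<le> \<Lambda>" using lam_antimono[of "q - 1" "k - 1"] less.prems k_le by (simp add: \<Lambda>_def)
  have \<Lambda>: "0 < \<Lambda>" using \<Lambda>k pos by simp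
  have lam0: "lam (k - 1) \<le> lam 0" using lam_antimono[of 0 "k - 1"] less.prems k_le by simp
  define K where "K = lam 0 / lam (k - 1)"
  have K: "1 \<le> K" using lam0 pos by (simp add: K_def)
  have lam0K: "lam 0 = K * lam (k - 1)" using pos by (simp add: K_def)
  have Gk: "G / (4 * (real k)\<^sup>2) \<le> G / 4"
    using G k by (intro divide_left_mono) auto
  have nonneg: "0 \<le> sqrt D * K" "0 \<le> sqrt \<delta>" using D0 K \<delta> by auto
  have "2 * (sqrt D * K) + 3 * \<gamma> + 3 * sqrt \<delta> \<le> G / 4"
    using order_trans[OF small[folded K_def] Gk] unfolding mult.assoc .
  then have sK: "sqrt D * K \<le> 1" "\<gamma> \<le> G / 2" using nonneg G1 G(1) \<gamma>(1) by linarith+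
  have "sqrt D \<le> sqrt D * K" using K D0 by (simp add: mult_le_cancel_left1)
  then have "sqrt D \<le> 1" using sK(1) by (rule order_trans)
  then have "sqrt D * (sqrt D * K) \<le> 1 * 1" using sK D0 K by (intro mult_mono) auto
  moreover have "sqrt D * (sqrt D * K) = D * K" using D0 by (simp flip: mult.assoc)
  ultimately have DK: "D * K \<le> 1" by simp
  have lam_p: "lam p \<le> 2 * \<Lambda>"
  proof -
    have "(1 - real (q - 1 - p) * G) * lam p \<le> lam (q - 1)"
      using p nogap G G1 lam_nonneg[OF pk(2)]
      by (intro antimono_chain_lower) (auto simp: gap_def not_less)
    moreover have "real (q - 1 - p) * G \<le> real k * G" using G less.prems by (intro mult_right_mono) auto
    then have "real (q - 1 - p) * G \<le> 1 / 2" using G(2) by (rule order_trans)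
    then have "1 / 2 \<le> 1 - real (q - 1 - p) * G" by linarith
    then have "(1/2) * lam p \<le> (1 - real (q - 1 - p) * G) * lam p"
      using lam_nonneg[OF pk(2)] by (rule mult_right_mono)
    ultimately show ?thesis by (simp add: \<Lambda>_def)
  qed
  have nu_le: "nu j 0 \<le> 3 * \<Lambda>" if j: "p \<le> j" "j < k" for j
  proof -
    have "D * lam 0 = (D * K) * lam (k - 1)" by (simp add: lam0K)
    also have "\<dots> \<le> 1 * lam (k - 1)" using DK pos by (intro mult_right_mono) auto
    finally have "D * lam 0 \<le> \<Lambda>" using \<Lambda>k by simp
    moreover have "nu j 0 \<le> lam p + D * lam 0"
      using rayleigh_after_capture[OF pk(1) mass_p_D] lam_nonneg[OF pk(2)] lam_nonneg[of 0] D0 pk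
      by (intro nu0_le[OF j]) auto
    ultimately show ?thesis using lam_p by simp
  qed
  define \<epsilon> where "\<epsilon> = 2 * sqrt D * lam 0 + 3 * (\<gamma> + sqrt \<delta>) * \<Lambda>"
  have \<epsilon>0: "0 \<le> \<epsilon>" using D0 lam0 pos \<gamma> \<delta> \<Lambda> by (simp add: \<epsilon>_def)
  have cross: "\<bar>u j \<bullet> (M *\<^sub>v a)\<bar> \<le> \<epsilon> * sqrt (a \<bullet> a)"
    if i: "p \<le> i" "i < q" and j: "j < i" and a: "orth_prefix i a" for i j a
  proof (cases "j < p")
    case True
    have "\<bar>u j \<bullet> (M *\<^sub>v a)\<bar> \<le> 2 * sqrt D * lam 0 * sqrt (a \<bullet> a)"
      using a i by (intro cross_term_after_capture[OF pk(1) mass_p_D True]) auto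
    also have "\<dots> \<le> \<epsilon> * sqrt (a \<bullet> a)"
      using \<gamma> \<delta> \<Lambda> by (intro mult_right_mono) (auto simp: \<epsilon>_def scalar_prod_self_nonneg)
    finally show ?thesis .
  next
    case False
    have jk: "j < k" using i j less.prems by simp
    have "\<bar>u j \<bullet> (M *\<^sub>v a)\<bar> \<le> (\<gamma> + sqrt \<delta>) * nu j 0 * sqrt (a \<bullet> a)"
      using a j by (intro cross_term_le jk) auto
    also have "\<dots> \<le> (\<gamma> + sqrt \<delta>) * (3 * \<Lambda>) * sqrt (a \<bullet> a)"
      using nu_le[of j] False jk \<gamma> \<delta>
      by (intro mult_right_mono mult_left_mono) (auto simp: scalar_prod_self_nonneg)
    also have "\<dots> \<le> \<epsilon> * sqrt (a \<bullet> a)"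
    proof (intro mult_right_mono)
      have "0 \<le> 2 * sqrt D * lam 0" using D0 lam0 pos by simp
      moreover have "(\<gamma> + sqrt \<delta>) * (3 * \<Lambda>) = 3 * (\<gamma> + sqrt \<delta>) * \<Lambda>" by simp
      ultimately show "(\<gamma> + sqrt \<delta>) * (3 * \<Lambda>) \<le> \<epsilon>" unfolding \<epsilon>_def by linarith
    qed (simp add: scalar_prod_self_nonneg)
    finally show ?thesis .
  qed
  have \<epsilon>_le: "\<epsilon> \<le> G / (4 * (real k)\<^sup>2) * \<Lambda>"
  proof -
    have "2 * sqrt D * lam 0 \<le> 2 * sqrt D * K * \<Lambda>"
      using \<Lambda>k K D0 unfolding lam0K mult.assoc by (intro mult_left_mono) auto
    then have "\<epsilon> \<le> (2 * sqrt D * K + 3 * \<gamma> + 3 * sqrt \<delta>) * \<Lambda>" by (simp add: \<epsilon>_def algebra_simps)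
    also have "\<dots> \<le> G / (4 * (real k)\<^sup>2) * \<Lambda>"
      using small[folded K_def] \<Lambda> by (intro mult_right_mono) auto
    finally show ?thesis .
  qed
  define S where "S = low_set G q"
  have S: "S \<subseteq> {q..<d}" unfolding S_def using G qd by (intro low_set_subset) auto
  then have S': "S \<subseteq> {..<d}" "S \<subseteq> {p..<d}" using p(1) by auto
  have finS: "finite S" using S finite_subset by blast
  define x where "x = (\<lambda>i. \<Sum>j<i. \<Sum>l\<in>S. (e l \<bullet> u j)\<^sup>2)"
  have x0: "0 \<le> x i" for i by (simp add: x_def sum_nonneg)
  \<comment> \<open>\<open>x i\<close> is the mass of the first \<open>i\<close> vectors on what is low for \<open>q\<close>, not for \<open>i\<close>.\<close>
  have step: "x (Suc i) \<le> (1 + 1 / real k) * x i + 2 * \<delta>" if i: "p \<le> i" "i < q" for i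
  proof -
    have ik: "i < k" using i less.prems by simp
    have "(G / 2) * \<Lambda> \<le> (G - \<gamma>) * \<Lambda>" using sK \<Lambda> by (intro mult_right_mono) auto
    also have "\<dots> = (1 - \<gamma>) * \<Lambda> - (1 - G) * \<Lambda>" by (simp add: algebra_simps)
    also have "(1 - \<gamma>) * \<Lambda> \<le> (1 - \<gamma>) * nu i 0"
      using order_trans[OF lam_antimono[OF _ qd(2)] lam_le_nu0[OF ik]] i \<gamma>
      by (intro mult_left_mono) (auto simp: \<Lambda>_def)
    finally have sep: "(G / 2) * \<Lambda> \<le> (1 - \<gamma>) * nu i 0 - (1 - G) * \<Lambda>" by simp
    have seppos: "0 < (G / 2) * \<Lambda>" using G \<Lambda> by simp
    have X: "L2_set (\<lambda>l. e l \<bullet> u j) S \<le> sqrt (x i)" if "j < i" for j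
      unfolding L2_set_def x_def using that
      by (intro real_sqrt_le_mono member_le_sum[of j "{..<i}" "\<lambda>j. \<Sum>l\<in>S. (e l \<bullet> u j)\<^sup>2"])
        (auto intro: sum_nonneg)
    have "L2_set (\<lambda>l. e l \<bullet> u i) S \<le>
        real i * \<epsilon> * sqrt (x i) / ((1 - \<gamma>) * nu i 0 - (1 - G) * \<Lambda>) + sqrt \<delta>"
    proof (rule step_low_part[OF ik S'(1) _ _ _ \<epsilon>0 _ X])
      show "0 \<le> (1 - G) * \<Lambda>" using G1 \<Lambda> by simp
      show "lam l \<le> (1 - G) * \<Lambda>" if "l \<in> S" for l using that by (simp add: S_def low_set_def \<Lambda>_def)
      show "(1 - G) * \<Lambda> < (1 - \<gamma>) * nu i 0" using sep seppos by linarith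
      show "\<bar>u j \<bullet> (M *\<^sub>v a)\<bar> \<le> \<epsilon> * sqrt (a \<bullet> a)" if "j < i" "orth_prefix i a" for j a
        using cross[OF i that] .
    qed (use x0 in auto)
    also have "real i * \<epsilon> * sqrt (x i) / ((1 - \<gamma>) * nu i 0 - (1 - G) * \<Lambda>)
        \<le> (real k * (G / (4 * (real k)\<^sup>2) * \<Lambda>) * sqrt (x i)) / ((G / 2) * \<Lambda>)"
      using sep seppos \<epsilon>_le \<epsilon>0 x0[of i] ik less_imp_le[OF G(1)] less_imp_le[OF \<Lambda>]
      by (intro frac_le mult_mono mult_nonneg_nonneg) auto
    also have "\<dots> = sqrt (x i) / (2 * real k)"
      using k G \<Lambda> by (simp add: field_simps power2_eq_square)
    finally have low: "L2_set (\<lambda>l. e l \<bullet> u i) S \<le> sqrt (x i) / (2 * real k) + sqrt \<delta>" by simp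
    have "(\<Sum>l\<in>S. (e l \<bullet> u i)\<^sup>2) = (L2_set (\<lambda>l. e l \<bullet> u i) S)\<^sup>2"
      by (simp add: L2_set_def sum_nonneg)
    also have "\<dots> \<le> (sqrt (x i) / (2 * real k) + sqrt \<delta>)\<^sup>2" using low by (intro power_mono) auto
    also have "\<dots> \<le> 2 * (sqrt (x i) / (2 * real k))\<^sup>2 + 2 * (sqrt \<delta>)\<^sup>2"
      using sum_squares_bound[of "sqrt (x i) / (2 * real k)" "sqrt \<delta>"]
      by (simp only: power2_sum)
    also have "\<dots> = x i / (2 * real k * real k) + 2 * \<delta>"
      using x0[of i] \<delta> by (simp add: power_divide power2_eq_square)
    also have "x i / (2 * real k * real k) \<le> x i / real k"
      using x0[of i] k by (intro divide_left_mono) auto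
    finally show ?thesis by (simp add: x_def algebra_simps)
  qed
  have "x q \<le> B q"
    using less_imp_le[OF p(1)]
  proof (rule dec_induct)
    \<comment> \<open>What is low for \<open>q\<close> is in particular at index \<open>p\<close> or later.\<close>
    have "x p \<le> (\<Sum>j<p. \<Sum>l\<in>{p..<d}. (e l \<bullet> u j)\<^sup>2)"
      unfolding x_def using S'(2) by (intro sum_mono sum_mono2) auto
    then show "x p \<le> B p" using mass_p by simp
  next
    fix i assume i: "p \<le> i" "i < q" and IH: "x i \<le> B i"
    have "x (Suc i) \<le> (1 + 1 / real k) * x i + 2 * \<delta>" by (rule step[OF i])
    also have "\<dots> \<le> (1 + 1 / real k) * B i + (1 + 1 / real k) ^ Suc i * (2 * \<delta>)"
      using IH k \<delta> mult_right_mono[OF one_le_power[of "1 + 1 / real k" "Suc i"], of "2 * \<delta>"]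
      by (intro add_mono mult_left_mono) auto
    also have "\<dots> = B (Suc i)" by (simp add: B_def algebra_simps add_divide_distrib)
    finally show "x (Suc i) \<le> B (Suc i)" .
  qed
  then show ?case by (simp add: x_def B_def S_def)
qed

end

section \<open>The algorithm as a deflation run\<close>

lemma outer_prod_mult_vec:
  assumes u: "u \<in> carrier_vec d" and x: "x \<in> carrier_vec d"
  shows "outer_prod u u *\<^sub>v x = (u \<bullet> x) \<cdot>\<^sub>v u"
  using assms
  by (intro eq_vecI) (auto simp: outer_prod_def scalar_prod_def sum_distrib_left mult_ac row_def
      intro!: sum.cong)

lemma zero_mat_quadratic: "x \<in> carrier_vec d \<Longrightarrow> x \<bullet> (0\<^sub>m d d *\<^sub>v x) = (0 :: real)"
  by (simp add: scalar_prod_def)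

lemma is_cPCA_iff:
  assumes A: "A \<in> carrier_mat d d" "A\<^sup>T = A" and e: "eigenbasis d A e lam" and k: "1 \<le> k" "k \<le> d"
  shows "is_cPCA d k \<Delta> \<Gamma> A U \<longleftrightarrow> U \<in> carrier_mat d k \<and> orthonormal_cols U \<and>
    (\<Sum>j<k. \<Sum>l | l < d \<and> lam l < (1 - \<Gamma>) * lam (k - 1). (e l \<bullet> col U j)\<^sup>2) \<le> \<Delta>"
  using frob_norm_V_less[OF A e, of U k "(1 - \<Gamma>) * lam (k - 1)"] eigval_eigenbasis[OF A(1) e k]
  by (auto simp: is_cPCA_def)

lemma orth_proj_fixes_col_span:
  assumes P: "orth_proj_mat d P" and u: "u \<in> col_span P"
  shows "u \<in> carrier_vec d" "P *\<^sub>v u = u"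
proof -
  have Pc: "P \<in> carrier_mat d d" "P * P = P" using P by (auto simp: orth_proj_mat_def)
  obtain c where c: "c \<in> carrier_vec d" "u = P *\<^sub>v c" using u col_span_eq[OF Pc(1)] by auto
  then show "u \<in> carrier_vec d" using Pc by simp
  show "P *\<^sub>v u = u" using c Pc assoc_mult_mat_vec[of P d d P d c] by simp
qed

text \<open>The vector returned in step \<open>i\<close> is fixed by \<open>P i\<close>, whose form makes it orthogonal to its
  predecessors; subtracting \<open>u i (u i)\<^sup>T\<close> then leaves a projection. A step is only
  guaranteed to succeed if \<open>P i \<noteq> 0\<close>, which holds as \<open>i < d\<close> vectors cannot span the space.\<close>

lemma deflation_proj_invariant:
  fixes orc :: "real mat \<Rightarrow> real mat \<Rightarrow> real vec" and M :: "real mat"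
  defines "P \<equiv> deflation_proj orc M"
  defines "u \<equiv> \<lambda>i. orc M (P i)"
  assumes M: "psd_mat d M" and orc: "is_cPCA_oracle d \<delta> \<gamma> orc" and i: "i \<le> d"
  shows "P i \<in> carrier_mat d d \<and> orthonormal_fam d i u \<and>
    (\<forall>x \<in> carrier_vec d. \<forall>y \<in> carrier_vec d.
      y \<bullet> (P i *\<^sub>v x) = y \<bullet> x - (\<Sum>j<i. (u j \<bullet> y) * (u j \<bullet> x))) \<and> orth_proj_mat d (P i)"
  using i
proof (induction i)
  case 0
  have "dim_row M = d" using M by (auto simp: psd_mat_def)
  then have "P 0 = 1\<^sub>m d" by (simp add: P_def)
  then show ?case by (simp add: orth_proj_mat_def orthonormal_fam_def)
next
  case (Suc i)
  then have IH: "P i \<in> carrier_mat d d" "orthonormal_fam d i u" "orth_proj_mat d (P i)"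
    "\<And>x y. x \<in> carrier_vec d \<Longrightarrow> y \<in> carrier_vec d \<Longrightarrow>
      y \<bullet> (P i *\<^sub>v x) = y \<bullet> x - (\<Sum>j<i. (u j \<bullet> y) * (u j \<bullet> x))" by auto
  have uc: "u j \<in> carrier_vec d" if "j < i" for j using IH(2) that by (simp add: orthonormal_fam_def)
  have PT: "(P i)\<^sup>T = P i" "P i * P i = P i" using IH(3) by (auto simp: orth_proj_mat_def)
  have "P i \<noteq> 0\<^sub>m d d"
  proof
    assume zero: "P i = 0\<^sub>m d d"
    obtain x where x: "x \<in> carrier_vec d" "x \<bullet> x = 1" "\<forall>j<i. u j \<bullet> x = 0"
      using underdetermined_homogeneous[of i d u, OF _ uc] Suc.prems by auto
    then show False using IH(4)[OF x(1) x(1)] zero zero_mat_quadratic[OF x(1)] by simp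
  qed
  then have v: "u i \<in> col_span (P i)" "u i \<bullet> u i = 1"
    using orc M IH(3) unfolding is_cPCA_oracle_def u_def by blast+
  note ui = orth_proj_fixes_col_span[OF IH(3) v(1)]
  have orth: "u j \<bullet> u i = 0" if j: "j < i" for j
  proof -
    have "(\<Sum>j'<i. (u j' \<bullet> u j) * (u j' \<bullet> u i)) = (\<Sum>j'<i. if j' = j then u j \<bullet> u i else 0)"
      using IH(2) j by (intro sum.cong) (auto simp: orthonormal_fam_def)
    also have "\<dots> = u j \<bullet> u i" using j by simp
    finally show ?thesis using IH(4)[OF ui(1) uc[OF j]] ui(2) by simp
  qed
  then have orth': "u i \<bullet> u j = 0" if "j < i" for j
    using that comm_scalar_prod[OF ui(1) uc[OF that]] by simp
  define Q where "Q = outer_prod (u i) (u i)"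
  have Qc: "Q \<in> carrier_mat d d" using ui(1) by (auto simp: Q_def outer_prod_def)
  have PS: "P (Suc i) = P i - Q" by (simp add: P_def u_def Q_def Let_def)
  have c: "P (Suc i) \<in> carrier_mat d d" unfolding PS by (rule minus_carrier_mat[OF Qc])
  have on: "orthonormal_fam d (Suc i) u"
    using IH(2) ui(1) v(2) orth orth' by (auto simp: orthonormal_fam_def less_Suc_eq)
  have vec: "P (Suc i) *\<^sub>v x = P i *\<^sub>v x - (u i \<bullet> x) \<cdot>\<^sub>v u i" if x: "x \<in> carrier_vec d" for x
    using IH(1) Qc x by (simp add: PS minus_mult_distrib_mat_vec Q_def outer_prod_mult_vec[OF ui(1) x])
  have form: "y \<bullet> (P (Suc i) *\<^sub>v x) = y \<bullet> x - (\<Sum>j<Suc i. (u j \<bullet> y) * (u j \<bullet> x))"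
    if x: "x \<in> carrier_vec d" and y: "y \<in> carrier_vec d" for x y
    using IH(1) x y ui(1) IH(4)[OF x y] comm_scalar_prod[OF y ui(1)]
    by (simp add: vec scalar_prod_minus_distrib[of _ d])
  have T: "(P (Suc i))\<^sup>T = P (Suc i)"
  proof -
    have "Q\<^sup>T = Q" by (auto simp: Q_def outer_prod_def)
    then show ?thesis using PT(1) IH(1) Qc transpose_minus[of "P i" d d Q] by (simp add: PS)
  qed
  have "P (Suc i) * P (Suc i) = P (Suc i)"
  proof -
    have PQ: "P i * Q = Q"
    proof (rule eq_matI)
      fix r c assume rc: "r < dim_row Q" "c < dim_col Q"
      then have rc': "r < d" "c < d" using Qc by auto
      have "col Q c = (u i $ c) \<cdot>\<^sub>v u i" using rc' ui(1) by (auto simp: Q_def outer_prod_def)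
      then have "P i *\<^sub>v col Q c = col Q c" using IH(1) ui by (simp add: mult_mat_vec)
      then have "col (P i * Q) c = col Q c" using col_mult2[OF IH(1) Qc rc'(2)] by simp
      then show "(P i * Q) $$ (r, c) = Q $$ (r, c)"
        using rc' IH(1) Qc by (metis carrier_matD index_col index_mult_mat(2,3))
    qed (use IH(1) Qc in auto)
    have QT: "Q\<^sup>T = Q" by (auto simp: Q_def outer_prod_def)
    have "Q * P i = Q" using arg_cong[OF PQ, of transpose_mat] transpose_mult[OF IH(1) Qc] PT(1) QT by simp
    moreover have "Q * Q = Q"
    proof (rule eq_matI)
      fix r c assume "r < dim_row Q" "c < dim_col Q"
      then have rc: "r < d" "c < d" using Qc by auto
      have "(Q * Q) $$ (r, c) = u i $ r * (u i \<bullet> u i) * u i $ c"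
        using rc ui(1) by (simp add: Q_def outer_prod_def scalar_prod_def sum_distrib_left sum_distrib_right mult_ac)
      then show "(Q * Q) $$ (r, c) = Q $$ (r, c)" using v(2) rc ui(1) by (simp add: Q_def outer_prod_def)
    qed (use Qc in auto)
    moreover have "(P i - Q) * (P i - Q) = (P i * P i - P i * Q) - (Q * P i - Q * Q)"
      using IH(1) Qc minus_carrier_mat[OF Qc, of "P i"] minus_mult_distrib_mat[OF IH(1) Qc, of "P i - Q" d]
        mult_minus_distrib_mat[OF IH(1) IH(1) Qc] mult_minus_distrib_mat[OF Qc IH(1) Qc] by simp
    ultimately show ?thesis using PQ PT(2) IH(1) Qc by (simp add: PS) (auto intro!: eq_matI)
  qed
  then have "orth_proj_mat d (P (Suc i))" using c T by (simp add: orth_proj_mat_def)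
  then show ?case using c on form by blast
qed

text \<open>The budget \<open>\<Gamma> / (8 k^3)\<close> on the right is spent as one quarter on \<open>2 sqrt D \<kappa>\<close>, one half on \<open>\<gamma>\<close> (hence
  the constant \<open>48\<close>) and one quarter on \<open>3 sqrt \<delta>\<close>. The first share needs
  \<open>k powr (44 ln k) \<ge> 2^15 k^7\<close>, which follows from \<open>44 ln k \<ge> 44 ln 2 \<ge> 22\<close> and \<open>k^15 \<ge> 2^15\<close>.\<close>

lemma cond_num_bounds:
  fixes k :: nat and \<Delta> \<Gamma> \<kappa> :: real
  assumes k: "2 \<le> k" and \<Delta>: "0 < \<Delta>" and \<Gamma>: "0 < \<Gamma>" "\<Gamma> < 1" and \<kappa>: "1 \<le> \<kappa>" and cond: "\<Delta> * \<kappa>\<^sup>2 \<le> \<Gamma>\<^sup>2"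
  defines "\<delta> \<equiv> \<Delta> / real k powr (44 * ln (real k))"
    and "D \<equiv> 6 * real k * (\<Delta> / real k powr (44 * ln (real k)))"
  shows "2 * sqrt D * \<kappa> + 3 * (\<Gamma> / (48 * real k ^ 3)) + 3 * sqrt \<delta> \<le> \<Gamma> / (2 * real k) / (4 * (real k)\<^sup>2)"
    and "D \<le> \<Delta>"
proof -
  have k2: "2 \<le> real k" using k by simp
  define N where "N = real k powr (44 * ln (real k))"
  have "exp (1 / 2) * exp (1 / 2) \<le> 2 * (2::real)" using exp_le by (simp flip: exp_add)
  then have "exp (1 / 2) \<le> (2::real)" by (metis abs_le_square_iff abs_numeral abs_exp_cancel power2_eq_square)
  then have "1 / 2 \<le> ln (2::real)" by (rule iffD2[OF ln_ge_iff, rotated]) simp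
  also have "ln 2 \<le> ln (real k)" using k2 by simp
  finally have "22 \<le> 44 * ln (real k)" by simp
  then have "real k powr 22 \<le> N" unfolding N_def using k2 by (intro powr_mono) auto
  then have "real k ^ 22 \<le> N" using k2 powr_realpow[of "real k" 22] by simp
  moreover have "real k ^ 22 = real k ^ 15 * real k ^ 7" by (simp flip: power_add)
  moreover have "(2::real) ^ 15 \<le> real k ^ 15" using k2 by (intro power_mono) auto
  then have "2 ^ 15 * real k ^ 7 \<le> real k ^ 15 * real k ^ 7" by (intro mult_right_mono) auto
  ultimately have N: "2 ^ 15 * real k ^ 7 \<le> N" by linarith
  have k7: "0 < real k ^ 7" "0 < real k ^ 6" using k2 by auto
  have N0: "0 < N" using N k7 by (smt (verit) zero_less_power mult_pos_pos)
  have \<delta>N: "\<delta> = \<Delta> / N" "D = 6 * real k * (\<Delta> / N)" by (simp_all add: \<delta>_def D_def N_def)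
  have \<delta>0: "0 < \<delta>" using \<Delta> N0 by (simp add: \<delta>N)
  have "\<delta> * \<kappa>\<^sup>2 \<le> \<Gamma>\<^sup>2 / N" using cond N0 by (simp add: \<delta>N divide_right_mono)
  also have "\<dots> \<le> \<Gamma>\<^sup>2 / (2 ^ 15 * real k ^ 7)" using N k7 by (intro frac_le) auto
  finally have d\<kappa>: "\<delta> * \<kappa>\<^sup>2 \<le> \<Gamma>\<^sup>2 / (2 ^ 15 * real k ^ 7)" .
  have kk: "real k ^ 7 = real k * real k ^ 6" by (simp flip: power_Suc)
  have "D * \<kappa>\<^sup>2 = 6 * real k * (\<delta> * \<kappa>\<^sup>2)" by (simp add: \<delta>N)
  also have "\<dots> \<le> 6 * real k * (\<Gamma>\<^sup>2 / (2 ^ 15 * real k ^ 7))" using d\<kappa> by (intro mult_left_mono) auto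
  also have "\<dots> = 6 * \<Gamma>\<^sup>2 / (2 ^ 15 * real k ^ 6)" using k2 by (simp add: kk)
  also have "\<dots> \<le> \<Gamma>\<^sup>2 / (2 ^ 12 * real k ^ 6)" using k7 by (simp add: field_simps)
  also have "\<dots> = (\<Gamma> / (64 * real k ^ 3))\<^sup>2" by (simp add: power_divide power_mult_distrib flip: power_mult)
  finally have "sqrt (D * \<kappa>\<^sup>2) \<le> sqrt ((\<Gamma> / (64 * real k ^ 3))\<^sup>2)" by (rule real_sqrt_le_mono)
  then have t1: "sqrt D * \<kappa> \<le> \<Gamma> / (64 * real k ^ 3)" using \<kappa> \<Gamma> k2 by (simp add: real_sqrt_mult)
  have "\<delta> * 1 \<le> \<delta> * \<kappa>\<^sup>2" using \<delta>0 \<kappa> by (intro mult_left_mono) auto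
  also note d\<kappa>
  also have "\<Gamma>\<^sup>2 / (2 ^ 15 * real k ^ 7) \<le> \<Gamma>\<^sup>2 / (96\<^sup>2 * real k ^ 6)"
    using k2 k7 unfolding kk mult.assoc[symmetric] by (intro divide_left_mono mult_right_mono) auto
  also have "\<dots> = (\<Gamma> / (96 * real k ^ 3))\<^sup>2" by (simp add: power_divide power_mult_distrib flip: power_mult)
  finally have "sqrt \<delta> \<le> sqrt ((\<Gamma> / (96 * real k ^ 3))\<^sup>2)" by (intro real_sqrt_le_mono) simp
  then have t2: "sqrt \<delta> \<le> \<Gamma> / (96 * real k ^ 3)" using \<Gamma> k2 by simp
  have "2 * sqrt D * \<kappa> + 3 * (\<Gamma> / (48 * real k ^ 3)) + 3 * sqrt \<delta> \<le>
      2 * (\<Gamma> / (64 * real k ^ 3)) + 3 * (\<Gamma> / (48 * real k ^ 3)) + 3 * (\<Gamma> / (96 * real k ^ 3))"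
    using t1 t2 by simp
  also have "\<dots> = \<Gamma> / (8 * real k ^ 3)" by (simp add: field_simps)
  also have "\<dots> = \<Gamma> / (2 * real k) / (4 * (real k)\<^sup>2)" by (simp add: power2_eq_square power3_eq_cube)
  finally show "2 * sqrt D * \<kappa> + 3 * (\<Gamma> / (48 * real k ^ 3)) + 3 * sqrt \<delta> \<le>
      \<Gamma> / (2 * real k) / (4 * (real k)\<^sup>2)" .
  have "1 \<le> real k ^ 6" using k2 by (intro one_le_power) simp
  moreover have "6 \<le> 2 ^ 15 * y" if "1 \<le> y" for y :: real using that by simp
  ultimately have "real k * 6 \<le> real k * (2 ^ 15 * real k ^ 6)" by (intro mult_left_mono) auto
  then have "6 * real k \<le> 2 ^ 15 * real k ^ 7" unfolding kk by (simp add: mult_ac)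
  then have "6 * real k \<le> N" using N by linarith
  then have "6 * real k * \<Delta> \<le> N * \<Delta>" using \<Delta> by (intro mult_right_mono) auto
  then show "D \<le> \<Delta>" using N0 by (simp add: \<delta>N field_simps)
qed

lemma growth_factor_le_three:
  assumes "1 \<le> k" "q \<le> k"
  shows "(1 + 1 / real k) ^ q \<le> 3"
proof -
  have "(1 + 1 / real k) ^ q \<le> (1 + 1 / real k) ^ k" using assms by (intro power_increasing) auto
  also have "\<dots> \<le> exp (1 / real k) ^ k" using assms by (intro power_mono exp_ge_add_one_self) auto
  also have "\<dots> = exp 1" using assms by (simp flip: exp_of_nat_mult)
  also have "\<dots> \<le> 3" by (rule exp_le)
  finally show ?thesis .
qed

lemma psd_mat_eigenvalues_nonneg:
  assumes M: "psd_mat d M" and e: "eigenbasis d M e lam" and l: "l < d"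
  shows "0 \<le> lam l"
proof -
  have el: "e l \<in> carrier_vec d" "e l \<bullet> e l = 1" "M *\<^sub>v e l = lam l \<cdot>\<^sub>v e l"
    using e l by (auto simp: eigenbasis_def orthonormal_fam_def)
  have "0 \<le> e l \<bullet> (M *\<^sub>v e l)" using M el(1) by (auto simp: psd_mat_def)
  then show ?thesis using el by simp
qed

theorem black_box_pca_correct:
  fixes orc :: "real mat \<Rightarrow> real mat \<Rightarrow> real vec"
  assumes k: "1 \<le> k" "k \<le> d" and \<Delta>: "0 < \<Delta>" "\<Delta> < 1" and \<Gamma>: "0 < \<Gamma>" "\<Gamma> < 1"
    and M: "psd_mat d M" and pos: "0 < eigval k M" and cond: "\<Delta> * (cond_num k M)\<^sup>2 \<le> \<Gamma>\<^sup>2"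
    and orc: "is_cPCA_oracle d (\<Delta> / real k powr (44 * ln (real k))) (\<Gamma> / (48 * real k ^ 3)) orc"
  shows "is_cPCA d k \<Delta> \<Gamma> M (BlackBoxPCA M k orc)"
proof -
  define \<delta> where "\<delta> = \<Delta> / real k powr (44 * ln (real k))"
  define \<gamma> where "\<gamma> = \<Gamma> / (48 * real k ^ 3)"
  define P where "P = deflation_proj orc M"
  define u where "u = (\<lambda>i. orc M (P i))"
  have orc': "is_cPCA_oracle d \<delta> \<gamma> orc" using orc by (simp add: \<delta>_def \<gamma>_def)
  have Mc: "M \<in> carrier_mat d d" "M\<^sup>T = M" using M by (auto simp: psd_mat_def)
  obtain e lam where e: "eigenbasis d M e lam" using spectral_theorem[OF Mc] by blast
  have inv: "P i \<in> carrier_mat d d \<and> orthonormal_fam d i u \<and>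
      (\<forall>x \<in> carrier_vec d. \<forall>y \<in> carrier_vec d.
        y \<bullet> (P i *\<^sub>v x) = y \<bullet> x - (\<Sum>j<i. (u j \<bullet> y) * (u j \<bullet> x))) \<and> orth_proj_mat d (P i)"
    if "i \<le> d" for i
    using deflation_proj_invariant[OF M orc' that] unfolding u_def P_def .
  have onu: "orthonormal_fam d k u" using inv[of k] k by blast
  have Pi: "P i \<in> carrier_mat d d" "(P i)\<^sup>T = P i" "orth_proj_mat d (P i)" if "i \<le> k" for i
    using inv[of i] that k by (auto simp: orth_proj_mat_def)
  have uc: "u j \<in> carrier_vec d" if "j < k" for j using onu that by (simp add: orthonormal_fam_def)
  have comp: "P i * M * P i \<in> carrier_mat d d" "(P i * M * P i)\<^sup>T = P i * M * P i" if "i < k" for i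
    using compression_symmetric[OF Pi(1,2) Mc] that by auto
  have "\<forall>i. \<exists>g m. i < k \<longrightarrow> eigenbasis d (P i * M * P i) g m" using spectral_theorem[OF comp] by blast
  then obtain f nu where f: "\<And>i. i < k \<Longrightarrow> eigenbasis d (P i * M * P i) (f i) (nu i)" by metis
  have d1: "1 \<le> d" using k by simp
  have mass: "(\<Sum>l | l < d \<and> nu i l < (1 - \<gamma>) * nu i 0. (f i l \<bullet> u i)\<^sup>2) \<le> \<delta>" if i: "i < k" for i
  proof -
    have "P i \<noteq> 0\<^sub>m d d"
    proof
      assume zero: "P i = 0\<^sub>m d d"
      have "u i \<in> carrier_vec d" "u i \<bullet> u i = 1" "\<forall>j<i. u j \<bullet> u i = 0"
        using onu i by (auto simp: orthonormal_fam_def)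
      moreover have "u i \<bullet> (P i *\<^sub>v u i) = u i \<bullet> u i - (\<Sum>j<i. (u j \<bullet> u i) * (u j \<bullet> u i))"
        using inv[of i] i k calculation(1) by auto
      ultimately show False using zero zero_mat_quadratic[of "u i" d] by simp
    qed
    then have "is_cPCA d 1 \<delta> \<gamma> (P i * M * P i) (mat_of_cols d [u i])"
      using orc' M Pi(3)[of i] i unfolding is_cPCA_oracle_def u_def by auto
    moreover have "col (mat_of_cols d [u i]) 0 = u i" using uc[OF i] by simp
    ultimately show ?thesis unfolding is_cPCA_iff[OF comp[OF i] f[OF i] order_refl d1] by simp
  qed
  define U where "U = BlackBoxPCA M k orc"
  have U_eq: "U = mat_of_cols d (map u [0..<k])"
    using Mc by (simp add: U_def BlackBoxPCA_def u_def P_def)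
  have U: "U \<in> carrier_mat d k" unfolding U_eq by (rule carrier_matI) auto
  have colU: "col U j = u j" if "j < k" for j using that uc[OF that] by (simp add: U_eq)
  have Uo: "orthonormal_cols U" unfolding orthonormal_cols_def
    using U onu by (intro eq_matI) (auto simp: colU orthonormal_fam_def)
  have lam_nonneg: "\<And>l. l < d \<Longrightarrow> 0 \<le> lam l" by (rule psd_mat_eigenvalues_nonneg[OF M e])
  have lamk: "0 < lam (k - 1)" using pos eigval_eigenbasis[OF Mc(1) e k] by simp
  have lam0: "lam (k - 1) \<le> lam 0" using e k by (auto simp: eigenbasis_def)
  have cond': "\<Delta> * (lam 0 / lam (k - 1))\<^sup>2 \<le> \<Gamma>\<^sup>2"
    using cond eigval_eigenbasis[OF Mc(1) e k] eigval_eigenbasis[OF Mc(1) e order_refl d1]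
    by (simp add: cond_num_def)
  have goal: "(\<Sum>j<k. \<Sum>l | l < d \<and> lam l < (1 - \<Gamma>) * lam (k - 1). (e l \<bullet> u j)\<^sup>2) \<le> \<Delta>"
  proof (cases "k = 1")
    case True
    have "P 0 = 1\<^sub>m d" using Mc by (simp add: P_def)
    then have PM: "P 0 * M * P 0 = M" using Mc by simp
    have "P 0 \<noteq> 0\<^sub>m d d" using \<open>P 0 = 1\<^sub>m d\<close> d1
      by (metis index_one_mat(1) index_zero_mat(1) less_eq_Suc_le One_nat_def zero_neq_one)
    then have "is_cPCA d 1 \<delta> \<gamma> (P 0 * M * P 0) (mat_of_cols d [u 0])"
      using orc' M Pi(3)[of 0] unfolding is_cPCA_oracle_def u_def by auto
    moreover have "col (mat_of_cols d [u 0]) 0 = u 0" using uc[of 0] True by simp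
    ultimately have "(\<Sum>l | l < d \<and> lam l < (1 - \<gamma>) * lam 0. (e l \<bullet> u 0)\<^sup>2) \<le> \<delta>"
      unfolding PM is_cPCA_iff[OF Mc e order_refl d1] by simp
    moreover have "(1 - \<Gamma>) * lam 0 \<le> (1 - \<gamma>) * lam 0"
      using True \<Gamma> lamk lam0 by (intro mult_right_mono) (auto simp: \<gamma>_def)
    then have "(\<Sum>l | l < d \<and> lam l < (1 - \<Gamma>) * lam 0. (e l \<bullet> u 0)\<^sup>2) \<le>
        (\<Sum>l | l < d \<and> lam l < (1 - \<gamma>) * lam 0. (e l \<bullet> u 0)\<^sup>2)"
      by (intro sum_mono2) auto
    ultimately show ?thesis using True by (simp add: \<delta>_def)
  next
    case False
    then have k2: "2 \<le> k" using k by simp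
    have k3: "1 \<le> real k ^ 3" using k by simp
    have \<gamma>01: "0 \<le> \<gamma>" "\<gamma> < 1" using \<Gamma> k3 by (auto simp: \<gamma>_def divide_less_eq)
    have \<delta>0: "0 \<le> \<delta>" using \<Delta> by (simp add: \<delta>_def)
    interpret deflation d k M e lam u P f nu \<delta> \<gamma>
    proof
      fix i :: nat and x y :: "real vec"
      assume "i \<le> k" "x \<in> carrier_vec d" "y \<in> carrier_vec d"
      then show "y \<bullet> (P i *\<^sub>v x) = y \<bullet> x - (\<Sum>j<i. (u j \<bullet> y) * (u j \<bullet> x))"
        using inv[of i] k by auto
    qed (use k Mc e lam_nonneg onu Pi f mass \<gamma>01 \<delta>0 in auto)
    define D where "D = 6 * real k * \<delta>"
    have \<kappa>: "1 \<le> lam 0 / lam (k - 1)" using lam0 lamk by simp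
    note bounds = cond_num_bounds[OF k2 \<Delta>(1) \<Gamma> \<kappa> cond', folded \<delta>_def \<gamma>_def, folded D_def]
    have D: "(1 + 1 / real k) ^ q * (2 * real q * \<delta>) \<le> D" if "q \<le> k" for q
    proof -
      have "(1 + 1 / real k) ^ q * (2 * real q * \<delta>) \<le> 3 * (2 * real k * \<delta>)"
        using that \<delta>0 growth_factor_le_three[OF k(1) that] by (intro mult_mono) auto
      then show ?thesis by (simp add: D_def)
    qed
    define G where "G = \<Gamma> / (2 * real k)"
    have G: "0 < G" "real k * G \<le> 1/2" "G \<le> \<Gamma>"
      using k \<Gamma> by (auto simp: G_def field_simps)
    have "(1 - \<Gamma>) * lam (k - 1) \<le> (1 - G) * lam (k - 1)" using G lamk by (intro mult_right_mono) auto
    then have sub: "{l. l < d \<and> lam l < (1 - \<Gamma>) * lam (k - 1)} \<subseteq> low_set G k" by (auto simp: low_set_def)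
    have fin: "finite (low_set G k)" by (simp add: low_set_def)
    have "(\<Sum>j<k. \<Sum>l | l < d \<and> lam l < (1 - \<Gamma>) * lam (k - 1). (e l \<bullet> u j)\<^sup>2)
        \<le> (\<Sum>j<k. \<Sum>l\<in>low_set G k. (e l \<bullet> u j)\<^sup>2)"
      using sub fin by (intro sum_mono sum_mono2) auto
    also have "\<dots> \<le> (1 + 1 / real k) ^ k * (2 * real k * \<delta>)"
      using bounds(1) D G k lamk by (intro low_mass_bound[of G D]) (auto simp: G_def)
    also have "\<dots> \<le> D" using D by simp
    also have "D \<le> \<Delta>" by (rule bounds(2))
    finally show ?thesis .
  qed
  have "(\<Sum>j<k. \<Sum>l | l < d \<and> lam l < (1 - \<Gamma>) * lam (k - 1). (e l \<bullet> col U j)\<^sup>2) \<le> \<Delta>"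
    using goal colU by simp
  then show ?thesis unfolding is_cPCA_iff[OF Mc e k] U_def[symmetric] using U Uo by blast
qed

theorem theorem2:
  shows "\<exists>C1 C2 :: real. 0 < C1 \<and> 0 < C2 \<and>
    (\<forall>(d::nat) (k::nat) (\<Delta>::real) (\<Gamma>::real) (M::real mat)
        (orc :: real mat \<Rightarrow> real mat \<Rightarrow> real vec).
       1 \<le> k \<longrightarrow> k \<le> d \<longrightarrow>
       0 < \<Delta> \<longrightarrow> \<Delta> < 1 \<longrightarrow> 0 < \<Gamma> \<longrightarrow> \<Gamma> < 1 \<longrightarrow>
       psd_mat d M \<longrightarrow> 0 < eigval k M \<longrightarrow>
       \<Delta> * (cond_num k M)\<^sup>2 \<le> \<Gamma>\<^sup>2 \<longrightarrow>
       is_cPCA_oracle d (\<Delta> / real k powr (C1 * ln (real k))) (\<Gamma> / (C2 * real k ^ 3)) orc \<longrightarrow>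
       is_cPCA d k \<Delta> \<Gamma> M (BlackBoxPCA M k orc))"
  using black_box_pca_correct by (intro exI[of _ 44] exI[of _ 48]) auto

end
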